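(* Let $E$ be an arbitrary directed graph, $K$ a field, and $X=P_l\cup P_c\cup P_{ec}\cup P_{b^\infty}$. Then $I(X)$ is a dense ideal of $L_K(E)$.
   Context: A directed graph $E=(E^0,E^1,s,r)$ consists of arbitrary sets $E^0$ (vertices), $E^1$ (edges) and maps $s,r:E^1\to E^0$ (source, range). A vertex $v$ is a sink if $s^{-1}(v)=\emptyset$, an infinite emitter if $s^{-1}(v)$ is infinite, and regular otherwise. A path is a vertex (length $0$) or a finite sequence of edges $e_1\cdots e_n$ with $r(e_i)=s(e_{i+1})$. Write $u\ge v$ if there is a path from $u$ to $v$, and $T(v)=\{u\in E^0: v\ge u\}$ (the tree of $v$). A cycle $c$ is a path $e_1\cdots e_n$, $n>0$, with $r(e_n)=s(e_1)$ and $s(e_i)\ne s(e_j)$ for $i\ne j$; $c^0$ is its set of vertices. An exit for it is an edge $e$ with $s(e)=s(e_i)$, $e\neq e_i$ for some $i$. A cycle $c$ is extreme if it has exits and for every path $\lambda$ starting at a vertex of $c^0$ there is a path $\mu$ with $s(\mu)=r(\lambda)$ and $r(\mu)\in c^0$. A bifurcation is a vertex $v$ with $|s^{-1}(v)|\ge 2$. A line point is a vertex whose tree contains no bifurcations and no (vertices of) cycles. $P_l$ is the set of line points, $P_c$ the set of vertices in cycles without exits, $P_{ec}$ the set of vertices in extreme cycles, and $P_{b^\infty}$ the set of vertices $v$ such that $T(v)$ contains infinitely many bifurcations or at least one infinite emitter. The Leavitt path algebra $L_K(E)$ is the $K$-algebra generated by $\{v: v\in E^0\}\cup\{e,e^*: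 e\in E^1\}$ subject to: $vw=\delta_{v,w}v$ for $v,w\in E^0$; $s(e)e=e\,r(e)=e$ and $r(e)e^*=e^*s(e)=e^*$ for $e\in E^1$; $e^*e'=\delta_{e,e'}r(e)$ for $e,e'\in E^1$; $v=\sum_{s(e)=v}ee^*$ for every regular vertex $v$. $I(X)$ is the two-sided ideal generated by $X$. A left ideal $I$ of a ring $R$ is dense if for all $x,y\in R$ with $x\neq 0$ there is $a\in R$ with $ax\ne0$ and $ay\in I$; an ideal is dense if it is dense as a left ideal. Since $L_K(E)$ is left nonsingular, dense is equivalent to essential. *)

theory Defs
  imports "Graph_Theory.Arc_Walk"
begin

section \<open>Distinguished vertices of a directed graph\<close>

text \<open>
  A directed graph with source map \<open>tail\<close> and range map \<open>head\<close> is a \<^locale>\<open>wf_digraph\<close>; its vertex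
  and edge sets may be empty or infinite, loops and parallel edges are allowed. Paths are arc walks
  (\<^const>\<open>pre_digraph.awalk\<close>), the empty walk at a vertex being the path of length 0.
\<close>

definition infinite_emitter :: "('a, 'b) pre_digraph \<Rightarrow> 'a \<Rightarrow> bool" where
  "infinite_emitter G v \<longleftrightarrow> v \<in> verts G \<and> infinite (out_arcs G v)"

definition regular_vertex :: "('a, 'b) pre_digraph \<Rightarrow> 'a \<Rightarrow> bool" where
  "regular_vertex G v \<longleftrightarrow> v \<in> verts G \<and> finite (out_arcs G v) \<and> out_arcs G v \<noteq> {}"

text \<open>Infinite emitters count as bifurcations; \<^const>\<open>card\<close> alone would miss them.\<close>

definition bifurcation :: "('a, 'b) pre_digraph \<Rightarrow> 'a \<Rightarrow> bool" where
  "bifurcation G v \<longleftrightarrow> v \<in> verts G \<and> (infinite (out_arcs G v) \<or> card (out_arcs G v) \<ge> 2)"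

definition vertex_tree :: "('a, 'b) pre_digraph \<Rightarrow> 'a \<Rightarrow> 'a set" where
  "vertex_tree G v = {u \<in> verts G. \<exists>p. pre_digraph.awalk G v p u}"

text \<open>
  \<^const>\<open>pre_digraph.cycle\<close> asks for a nonempty closed walk whose ranges are pairwise distinct. The
  ranges of a closed walk are a rotation of its sources, so this says that the sources are distinct.
\<close>

definition cycle_verts :: "('a, 'b) pre_digraph \<Rightarrow> 'b list \<Rightarrow> 'a set" where
  "cycle_verts G c = tail G ` set c"

definition cycle_exit :: "('a, 'b) pre_digraph \<Rightarrow> 'b list \<Rightarrow> 'b \<Rightarrow> bool" where
  "cycle_exit G c e \<longleftrightarrow> e \<in> arcs G \<and> (\<exists>f \<in> set c. tail G e = tail G f \<and> e \<noteq> f)"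

definition extreme_cycle :: "('a, 'b) pre_digraph \<Rightarrow> 'b list \<Rightarrow> bool" where
  "extreme_cycle G c \<longleftrightarrow>
     pre_digraph.cycle G c \<and> (\<exists>e. cycle_exit G c e) \<and>
     (\<forall>u \<in> cycle_verts G c. \<forall>p w. pre_digraph.awalk G u p w \<longrightarrow>
        (\<exists>q z. pre_digraph.awalk G w q z \<and> z \<in> cycle_verts G c))"

definition P_l :: "('a, 'b) pre_digraph \<Rightarrow> 'a set" where
  "P_l G = {v \<in> verts G. \<forall>u \<in> vertex_tree G v.
     \<not> bifurcation G u \<and> \<not> (\<exists>c. pre_digraph.cycle G c \<and> u \<in> cycle_verts G c)}"

definition P_c :: "('a, 'b) pre_digraph \<Rightarrow> 'a set" where
  "P_c G = {v. \<exists>c. pre_digraph.cycle G c \<and> \<not> (\<exists>e. cycle_exit G c e) \<and> v \<in> cycle_verts G c}"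

definition P_ec :: "('a, 'b) pre_digraph \<Rightarrow> 'a set" where
  "P_ec G = {v. \<exists>c. extreme_cycle G c \<and> v \<in> cycle_verts G c}"

definition P_binf :: "('a, 'b) pre_digraph \<Rightarrow> 'a set" where
  "P_binf G = {v \<in> verts G. infinite {u \<in> vertex_tree G v. bifurcation G u} \<or>
     (\<exists>u \<in> vertex_tree G v. infinite_emitter G u)}"


section \<open>Algebras without unit, ideals, density\<close>

text \<open>
  A Leavitt path algebra has no unit when the graph has infinitely many vertices, so the rings and
  ideals of HOL-Algebra, which are unital, do not apply.
\<close>

record 'r rng =
  rng_carrier :: "'r set"
  rng_zero :: 'r
  rng_add :: "'r \<Rightarrow> 'r \<Rightarrow> 'r"
  rng_uminus :: "'r \<Rightarrow> 'r"
  rng_mult :: "'r \<Rightarrow> 'r \<Rightarrow> 'r"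

record ('k, 'r) rng_algebra = "'r rng" +
  rng_scale :: "'k \<Rightarrow> 'r \<Rightarrow> 'r"

locale nonunital_ring =
  fixes R :: "('r, 'm) rng_scheme"
  assumes zero_closed: "rng_zero R \<in> rng_carrier R"
    and add_closed: "\<And>x y. x \<in> rng_carrier R \<Longrightarrow> y \<in> rng_carrier R \<Longrightarrow>
      rng_add R x y \<in> rng_carrier R"
    and uminus_closed: "\<And>x. x \<in> rng_carrier R \<Longrightarrow> rng_uminus R x \<in> rng_carrier R"
    and mult_closed: "\<And>x y. x \<in> rng_carrier R \<Longrightarrow> y \<in> rng_carrier R \<Longrightarrow>
      rng_mult R x y \<in> rng_carrier R"
    and add_assoc: "\<And>x y z. x \<in> rng_carrier R \<Longrightarrow> y \<in> rng_carrier R \<Longrightarrow> z \<in> rng_carrier R \<Longrightarrow>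
      rng_add R (rng_add R x y) z = rng_add R x (rng_add R y z)"
    and add_commute: "\<And>x y. x \<in> rng_carrier R \<Longrightarrow> y \<in> rng_carrier R \<Longrightarrow>
      rng_add R x y = rng_add R y x"
    and add_zero: "\<And>x. x \<in> rng_carrier R \<Longrightarrow> rng_add R (rng_zero R) x = x"
    and add_uminus: "\<And>x. x \<in> rng_carrier R \<Longrightarrow> rng_add R (rng_uminus R x) x = rng_zero R"
    and mult_assoc: "\<And>x y z. x \<in> rng_carrier R \<Longrightarrow> y \<in> rng_carrier R \<Longrightarrow> z \<in> rng_carrier R \<Longrightarrow>
      rng_mult R (rng_mult R x y) z = rng_mult R x (rng_mult R y z)"
    and distrib_left: "\<And>x y z. x \<in> rng_carrier R \<Longrightarrow> y \<in> rng_carrier R \<Longrightarrow> z \<in> rng_carrier R \<Longrightarrow>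
      rng_mult R x (rng_add R y z) = rng_add R (rng_mult R x y) (rng_mult R x z)"
    and distrib_right: "\<And>x y z. x \<in> rng_carrier R \<Longrightarrow> y \<in> rng_carrier R \<Longrightarrow> z \<in> rng_carrier R \<Longrightarrow>
      rng_mult R (rng_add R x y) z = rng_add R (rng_mult R x z) (rng_mult R y z)"

locale nonunital_algebra = nonunital_ring R
  for R :: "('k::field, 'r, 'm) rng_algebra_scheme" +
  assumes scale_closed: "\<And>a x. x \<in> rng_carrier R \<Longrightarrow> rng_scale R a x \<in> rng_carrier R"
    and scale_add_right: "\<And>a x y. x \<in> rng_carrier R \<Longrightarrow> y \<in> rng_carrier R \<Longrightarrow>
      rng_scale R a (rng_add R x y) = rng_add R (rng_scale R a x) (rng_scale R a y)"
    and scale_add_left: "\<And>a b x. x \<in> rng_carrier R \<Longrightarrow>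
      rng_scale R (a + b) x = rng_add R (rng_scale R a x) (rng_scale R b x)"
    and scale_scale: "\<And>a b x. x \<in> rng_carrier R \<Longrightarrow>
      rng_scale R a (rng_scale R b x) = rng_scale R (a * b) x"
    and scale_one: "\<And>x. x \<in> rng_carrier R \<Longrightarrow> rng_scale R 1 x = x"
    and mult_scale_left: "\<And>a x y. x \<in> rng_carrier R \<Longrightarrow> y \<in> rng_carrier R \<Longrightarrow>
      rng_mult R (rng_scale R a x) y = rng_scale R a (rng_mult R x y)"
    and mult_scale_right: "\<And>a x y. x \<in> rng_carrier R \<Longrightarrow> y \<in> rng_carrier R \<Longrightarrow>
      rng_mult R x (rng_scale R a y) = rng_scale R a (rng_mult R x y)"

definition rng_left_ideal :: "('r, 'm) rng_scheme \<Rightarrow> 'r set \<Rightarrow> bool" where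
  "rng_left_ideal R I \<longleftrightarrow>
     I \<subseteq> rng_carrier R \<and> rng_zero R \<in> I \<and>
     (\<forall>x \<in> I. \<forall>y \<in> I. rng_add R x y \<in> I) \<and> (\<forall>x \<in> I. rng_uminus R x \<in> I) \<and>
     (\<forall>a \<in> rng_carrier R. \<forall>x \<in> I. rng_mult R a x \<in> I)"

definition rng_ideal :: "('r, 'm) rng_scheme \<Rightarrow> 'r set \<Rightarrow> bool" where
  "rng_ideal R I \<longleftrightarrow>
     rng_left_ideal R I \<and> (\<forall>a \<in> rng_carrier R. \<forall>x \<in> I. rng_mult R x a \<in> I)"

definition rng_ideal_generated :: "('r, 'm) rng_scheme \<Rightarrow> 'r set \<Rightarrow> 'r set" where
  "rng_ideal_generated R X = \<Inter> {I. rng_ideal R I \<and> X \<subseteq> I}"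

definition dense_left_ideal :: "('r, 'm) rng_scheme \<Rightarrow> 'r set \<Rightarrow> bool" where
  "dense_left_ideal R I \<longleftrightarrow>
     rng_left_ideal R I \<and>
     (\<forall>x \<in> rng_carrier R. \<forall>y \<in> rng_carrier R. x \<noteq> rng_zero R \<longrightarrow>
        (\<exists>a \<in> rng_carrier R. rng_mult R a x \<noteq> rng_zero R \<and> rng_mult R a y \<in> I))"

definition dense_ideal :: "('r, 'm) rng_scheme \<Rightarrow> 'r set \<Rightarrow> bool" where
  "dense_ideal R I \<longleftrightarrow> rng_ideal R I \<and> dense_left_ideal R I"


section \<open>The Leavitt path algebra\<close>

text \<open>
  The algebra given by generators and relations: formal expressions in the generators
  modulo the least congruence that contains the axioms of a (not necessarily unital) associative
  \<open>K\<close>-algebra and the defining relations.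
\<close>

datatype (dead 'k, lpa_verts: 'a, lpa_arcs: 'b) lpa_term =
    Vertex 'a
  | Edge 'b
  | Ghost 'b
  | Zero
  | Add "('k, 'a, 'b) lpa_term" "('k, 'a, 'b) lpa_term"
  | Neg "('k, 'a, 'b) lpa_term"
  | Mult "('k, 'a, 'b) lpa_term" "('k, 'a, 'b) lpa_term"
  | Scale 'k "('k, 'a, 'b) lpa_term"

definition lpa_terms :: "('a, 'b) pre_digraph \<Rightarrow> ('k, 'a, 'b) lpa_term set" where
  "lpa_terms G = {t. lpa_verts t \<subseteq> verts G \<and> lpa_arcs t \<subseteq> arcs G}"

text \<open>
  In \<open>CK2\<close> the list \<open>es\<close> enumerates the edges emitted by \<open>v\<close> without repetition; the order is
  immaterial, addition being commutative modulo the congruence.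
\<close>

inductive_set lpa_cong ::
    "('a, 'b) pre_digraph \<Rightarrow> (('k::field, 'a, 'b) lpa_term \<times> ('k, 'a, 'b) lpa_term) set"
  for G :: "('a, 'b) pre_digraph" where
  refl: "x \<in> lpa_terms G \<Longrightarrow> (x, x) \<in> lpa_cong G"
| sym: "(x, y) \<in> lpa_cong G \<Longrightarrow> (y, x) \<in> lpa_cong G"
| trans: "(x, y) \<in> lpa_cong G \<Longrightarrow> (y, z) \<in> lpa_cong G \<Longrightarrow> (x, z) \<in> lpa_cong G"
| Add_cong: "(x, x') \<in> lpa_cong G \<Longrightarrow> (y, y') \<in> lpa_cong G \<Longrightarrow> (Add x y, Add x' y') \<in> lpa_cong G"
| Neg_cong: "(x, x') \<in> lpa_cong G \<Longrightarrow> (Neg x, Neg x') \<in> lpa_cong G"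
| Mult_cong: "(x, x') \<in> lpa_cong G \<Longrightarrow> (y, y') \<in> lpa_cong G \<Longrightarrow> (Mult x y, Mult x' y') \<in> lpa_cong G"
| Scale_cong: "(x, x') \<in> lpa_cong G \<Longrightarrow> (Scale a x, Scale a x') \<in> lpa_cong G"

| Add_assoc: "x \<in> lpa_terms G \<Longrightarrow> y \<in> lpa_terms G \<Longrightarrow> z \<in> lpa_terms G \<Longrightarrow>
    (Add (Add x y) z, Add x (Add y z)) \<in> lpa_cong G"
| Add_commute: "x \<in> lpa_terms G \<Longrightarrow> y \<in> lpa_terms G \<Longrightarrow> (Add x y, Add y x) \<in> lpa_cong G"
| Add_Zero: "x \<in> lpa_terms G \<Longrightarrow> (Add Zero x, x) \<in> lpa_cong G"
| Add_Neg: "x \<in> lpa_terms G \<Longrightarrow> (Add (Neg x) x, Zero) \<in> lpa_cong G"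
| Mult_assoc: "x \<in> lpa_terms G \<Longrightarrow> y \<in> lpa_terms G \<Longrightarrow> z \<in> lpa_terms G \<Longrightarrow>
    (Mult (Mult x y) z, Mult x (Mult y z)) \<in> lpa_cong G"
| distrib_left: "x \<in> lpa_terms G \<Longrightarrow> y \<in> lpa_terms G \<Longrightarrow> z \<in> lpa_terms G \<Longrightarrow>
    (Mult x (Add y z), Add (Mult x y) (Mult x z)) \<in> lpa_cong G"
| distrib_right: "x \<in> lpa_terms G \<Longrightarrow> y \<in> lpa_terms G \<Longrightarrow> z \<in> lpa_terms G \<Longrightarrow>
    (Mult (Add x y) z, Add (Mult x z) (Mult y z)) \<in> lpa_cong G"
| Scale_Add: "x \<in> lpa_terms G \<Longrightarrow> y \<in> lpa_terms G \<Longrightarrow>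
    (Scale a (Add x y), Add (Scale a x) (Scale a y)) \<in> lpa_cong G"
| Scale_plus: "x \<in> lpa_terms G \<Longrightarrow> (Scale (a + b) x, Add (Scale a x) (Scale b x)) \<in> lpa_cong G"
| Scale_Scale: "x \<in> lpa_terms G \<Longrightarrow> (Scale a (Scale b x), Scale (a * b) x) \<in> lpa_cong G"
| Scale_one: "x \<in> lpa_terms G \<Longrightarrow> (Scale 1 x, x) \<in> lpa_cong G"
| Mult_Scale_left: "x \<in> lpa_terms G \<Longrightarrow> y \<in> lpa_terms G \<Longrightarrow>
    (Mult (Scale a x) y, Scale a (Mult x y)) \<in> lpa_cong G"
| Mult_Scale_right: "x \<in> lpa_terms G \<Longrightarrow> y \<in> lpa_terms G \<Longrightarrow>
    (Mult x (Scale a y), Scale a (Mult x y)) \<in> lpa_cong G"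

| Vertex_idem: "v \<in> verts G \<Longrightarrow> (Mult (Vertex v) (Vertex v), Vertex v) \<in> lpa_cong G"
| Vertex_orth: "v \<in> verts G \<Longrightarrow> w \<in> verts G \<Longrightarrow> v \<noteq> w \<Longrightarrow>
    (Mult (Vertex v) (Vertex w), Zero) \<in> lpa_cong G"
| source_Edge: "e \<in> arcs G \<Longrightarrow> tail G e \<in> verts G \<Longrightarrow>
    (Mult (Vertex (tail G e)) (Edge e), Edge e) \<in> lpa_cong G"
| Edge_range: "e \<in> arcs G \<Longrightarrow> head G e \<in> verts G \<Longrightarrow>
    (Mult (Edge e) (Vertex (head G e)), Edge e) \<in> lpa_cong G"
| range_Ghost: "e \<in> arcs G \<Longrightarrow> head G e \<in> verts G \<Longrightarrow>
    (Mult (Vertex (head G e)) (Ghost e), Ghost e) \<in> lpa_cong G"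
| Ghost_source: "e \<in> arcs G \<Longrightarrow> tail G e \<in> verts G \<Longrightarrow>
    (Mult (Ghost e) (Vertex (tail G e)), Ghost e) \<in> lpa_cong G"
| CK1_same: "e \<in> arcs G \<Longrightarrow> head G e \<in> verts G \<Longrightarrow>
    (Mult (Ghost e) (Edge e), Vertex (head G e)) \<in> lpa_cong G"
| CK1_diff: "e \<in> arcs G \<Longrightarrow> f \<in> arcs G \<Longrightarrow> e \<noteq> f \<Longrightarrow> (Mult (Ghost e) (Edge f), Zero) \<in> lpa_cong G"
| CK2: "regular_vertex G v \<Longrightarrow> distinct es \<Longrightarrow> set es = out_arcs G v \<Longrightarrow>
    (Vertex v, foldr (\<lambda>e t. Add (Mult (Edge e) (Ghost e)) t) es Zero) \<in> lpa_cong G"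

definition lpa_class ::
    "('a, 'b) pre_digraph \<Rightarrow> ('k::field, 'a, 'b) lpa_term \<Rightarrow> ('k, 'a, 'b) lpa_term set" where
  "lpa_class G t = lpa_cong G `` {t}"

definition leavitt_path_algebra ::
    "('a, 'b) pre_digraph \<Rightarrow> ('k::field, ('k, 'a, 'b) lpa_term set) rng_algebra" where
  "leavitt_path_algebra G =
     \<lparr>rng_carrier = lpa_terms G // lpa_cong G,
      rng_zero = lpa_class G Zero,
      rng_add = (\<lambda>A B. \<Union>x \<in> A. \<Union>y \<in> B. lpa_class G (Add x y)),
      rng_uminus = (\<lambda>A. \<Union>x \<in> A. lpa_class G (Neg x)),
      rng_mult = (\<lambda>A B. \<Union>x \<in> A. \<Union>y \<in> B. lpa_class G (Mult x y)),
      rng_scale = (\<lambda>a A. \<Union>x \<in> A. lpa_class G (Scale a x))\<rparr>"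

lemma lpa_terms_simps [simp]:
  "Vertex v \<in> lpa_terms G \<longleftrightarrow> v \<in> verts G"
  "Edge e \<in> lpa_terms G \<longleftrightarrow> e \<in> arcs G"
  "Ghost e \<in> lpa_terms G \<longleftrightarrow> e \<in> arcs G"
  "Zero \<in> lpa_terms G"
  "Add x y \<in> lpa_terms G \<longleftrightarrow> x \<in> lpa_terms G \<and> y \<in> lpa_terms G"
  "Neg x \<in> lpa_terms G \<longleftrightarrow> x \<in> lpa_terms G"
  "Mult x y \<in> lpa_terms G \<longleftrightarrow> x \<in> lpa_terms G \<and> y \<in> lpa_terms G"
  "Scale a x \<in> lpa_terms G \<longleftrightarrow> x \<in> lpa_terms G"
  by (auto simp: lpa_terms_def)

lemma lpa_cong_terms: "(x, y) \<in> lpa_cong G \<Longrightarrow> x \<in> lpa_terms G \<and> y \<in> lpa_terms G"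
proof (induction rule: lpa_cong.induct)
  case (CK2 v es)
  have "foldr (\<lambda>e t. Add (Mult (Edge e) (Ghost e)) t) es Zero \<in> lpa_terms G"
    if "set es \<subseteq> arcs G" using that by (induction es) auto
  with CK2 show ?case by (auto simp: regular_vertex_def out_arcs_def)
qed auto

lemma equiv_lpa_cong: "equiv (lpa_terms G) (lpa_cong G)"
proof (rule equivI)
  show "lpa_cong G \<subseteq> lpa_terms G \<times> lpa_terms G"
    by (auto dest: lpa_cong_terms)
  show "refl_on (lpa_terms G) (lpa_cong G)"
    by (simp add: refl_on_def lpa_cong.refl)
  show "sym (lpa_cong G)"
    by (rule symI) (rule lpa_cong.sym)
  show "trans (lpa_cong G)"
    by (rule transI) (rule lpa_cong.trans)
qed

lemma lpa_class_eq_iff: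
  "x \<in> lpa_terms G \<Longrightarrow> y \<in> lpa_terms G \<Longrightarrow> lpa_class G x = lpa_class G y \<longleftrightarrow> (x, y) \<in> lpa_cong G"
  unfolding lpa_class_def by (rule eq_equiv_class_iff[OF equiv_lpa_cong])

lemma lpa_carrier: "rng_carrier (leavitt_path_algebra G) = lpa_class G ` lpa_terms G"
  by (auto simp: leavitt_path_algebra_def quotient_def lpa_class_def)

lemma lpa_UN_class:
  assumes "x \<in> lpa_terms G" and "\<And>x'. (x, x') \<in> lpa_cong G \<Longrightarrow> f x' = f x"
  shows "(\<Union>x' \<in> lpa_class G x. f x') = f x"
proof (rule UN_constant_eq)
  show "x \<in> lpa_class G x"
    using assms(1) by (simp add: lpa_class_def lpa_cong.refl)
  show "\<forall>x' \<in> lpa_class G x. f x' = f x"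
    using assms(2) by (simp add: lpa_class_def)
qed

lemma lpa_class_eqI: "(x, y) \<in> lpa_cong G \<Longrightarrow> lpa_class G x = lpa_class G y"
  by (simp add: lpa_class_eq_iff lpa_cong_terms)

lemma lpa_zero: "rng_zero (leavitt_path_algebra G) = lpa_class G Zero"
  by (simp add: leavitt_path_algebra_def)

lemma lpa_uminus:
  assumes "x \<in> lpa_terms G"
  shows "rng_uminus (leavitt_path_algebra G) (lpa_class G x) = lpa_class G (Neg x)"
  unfolding leavitt_path_algebra_def rng.simps using assms
  by (rule lpa_UN_class) (rule lpa_class_eqI[symmetric], rule lpa_cong.Neg_cong)

lemma lpa_scale:
  assumes "x \<in> lpa_terms G"
  shows "rng_scale (leavitt_path_algebra G) a (lpa_class G x) = lpa_class G (Scale a x)"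
  unfolding leavitt_path_algebra_def rng_algebra.simps using assms
  by (rule lpa_UN_class) (rule lpa_class_eqI[symmetric], rule lpa_cong.Scale_cong)

lemma lpa_UN_class2:
  assumes x: "x \<in> lpa_terms G" and y: "y \<in> lpa_terms G"
    and f: "\<And>x' y'. (x, x') \<in> lpa_cong G \<Longrightarrow> (y, y') \<in> lpa_cong G \<Longrightarrow> f x' y' = f x y"
  shows "(\<Union>x' \<in> lpa_class G x. \<Union>y' \<in> lpa_class G y. f x' y') = f x y"
proof -
  have "(\<Union>y' \<in> lpa_class G y. f x' y') = f x y" if "(x, x') \<in> lpa_cong G" for x'
  proof (rule UN_constant_eq)
    show "y \<in> lpa_class G y"
      using y by (simp add: lpa_class_def lpa_cong.refl)
    show "\<forall>y' \<in> lpa_class G y. f x' y' = f x y"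
      using f[OF that] by (simp add: lpa_class_def)
  qed
  then have "\<forall>x' \<in> lpa_class G x. (\<Union>y' \<in> lpa_class G y. f x' y') = f x y"
    by (simp add: lpa_class_def)
  moreover have "x \<in> lpa_class G x"
    using x by (simp add: lpa_class_def lpa_cong.refl)
  ultimately show ?thesis
    by (intro UN_constant_eq)
qed

lemma lpa_add:
  assumes "x \<in> lpa_terms G" "y \<in> lpa_terms G"
  shows "rng_add (leavitt_path_algebra G) (lpa_class G x) (lpa_class G y) = lpa_class G (Add x y)"
  unfolding leavitt_path_algebra_def rng.simps using assms
  by (rule lpa_UN_class2) (rule lpa_class_eqI[symmetric], rule lpa_cong.Add_cong)

lemma lpa_mult:
  assumes "x \<in> lpa_terms G" "y \<in> lpa_terms G"
  shows "rng_mult (leavitt_path_algebra G) (lpa_class G x) (lpa_class G y) = lpa_class G (Mult x y)"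
  unfolding leavitt_path_algebra_def rng.simps using assms
  by (rule lpa_UN_class2) (rule lpa_class_eqI[symmetric], rule lpa_cong.Mult_cong)

theorem nonunital_algebra_leavitt_path_algebra: "nonunital_algebra (leavitt_path_algebra G)"
  by unfold_locales
    (auto simp: lpa_carrier lpa_zero lpa_add lpa_uminus lpa_mult lpa_scale lpa_class_eq_iff
      intro: lpa_cong.Add_assoc lpa_cong.Add_commute lpa_cong.Add_Zero lpa_cong.Add_Neg
        lpa_cong.Mult_assoc lpa_cong.distrib_left lpa_cong.distrib_right lpa_cong.Scale_Add
        lpa_cong.Scale_plus lpa_cong.Scale_Scale lpa_cong.Scale_one lpa_cong.Mult_Scale_left
        lpa_cong.Mult_Scale_right
      del: equalityI subset_antisym)

end

theory Submission
  imports Defs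
begin

text \<open>
  Every vertex \<open>v\<close> reaches a vertex of \<open>X\<close>: if its tree has finitely many bifurcations and no
  infinite emitter, move to a vertex of the tree that sees as few bifurcations as possible. If it
  sees none, it leads to a line point or to a cycle without exits; otherwise every vertex of its
  tree sees the same bifurcations, and each of these lies on an extreme cycle.

  For density it suffices that every \<open>x \<noteq> 0\<close> has some \<open>a \<in> I(X)\<close> with \<open>a x \<noteq> 0\<close>. Multiplying \<open>x\<close> on
  the right by a suitable path removes all ghost edges, so that \<open>x \<nu>\<close> is a nonzero combination of
  real paths ending at one vertex \<open>w\<close>. Let \<open>\<lambda>\<close> be one of these paths and \<open>\<tau>\<close> a path from \<open>w\<close> to \<open>X\<close>.
  Then \<open>a = (\<lambda> \<tau>)\<^sup>*\<close> lies in \<open>I(X)\<close>, and \<open>a x \<nu> \<tau> \<noteq> 0\<close> is read off from a graded representation of the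
  algebra on boundary paths.
\<close>

section \<open>Every vertex reaches the distinguished set\<close>

context wf_digraph
begin

lemma vertex_tree_iff: "u \<in> vertex_tree G v \<longleftrightarrow> (\<exists>p. awalk v p u)"
  by (auto simp: vertex_tree_def)

lemma vertex_tree_refl: "v \<in> verts G \<Longrightarrow> v \<in> vertex_tree G v"
  by (auto simp: vertex_tree_iff awalk_Nil_iff intro: exI[of _ "[]"])

lemma vertex_tree_subset: "u \<in> vertex_tree G v \<Longrightarrow> vertex_tree G u \<subseteq> vertex_tree G v"
  by (auto simp: vertex_tree_iff) (metis awalk_appendI)

lemma cycle_verts_awalk:
  assumes "cycle c" "u \<in> cycle_verts G c" "w \<in> cycle_verts G c"
  shows "w \<in> vertex_tree G u"
proof -
  obtain z where z: "awalk z c z"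
    using assms(1) by (auto simp: cycle_def)
  have split: "(\<exists>p. awalk z p x) \<and> (\<exists>p. awalk x p z)" if "x \<in> cycle_verts G c" for x
  proof -
    obtain f c1 c2 where "x = tail G f" "c = c1 @ f # c2"
      using \<open>x \<in> cycle_verts G c\<close> by (auto simp: cycle_verts_def dest: split_list)
    with z show ?thesis
      by (metis awalk_Cons_iff awalk_append_iff)
  qed
  then show ?thesis
    using assms(2,3) by (auto simp: vertex_tree_iff) (meson awalk_appendI)
qed

text \<open>Once the return walk is shortened to one without repeated vertices, the vertices of
  \<open>e # p\<close> after the first are those of the walk \<open>p\<close>, and these are the
  ones that \<open>cycle\<close> wants distinct. A loop is the case \<open>p = []\<close>.\<close>

lemma closed_walk_cycle:
  assumes e: "e \<in> arcs G" and ret: "tail G e \<in> vertex_tree G (head G e)"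
  obtains c where "cycle c" "e \<in> set c"
proof -
  obtain p where "apath (head G e) p (tail G e)"
    using ret apath_awalk_to_apath by (auto simp: vertex_tree_iff)
  then have "cycle (e # p)"
    using e by (auto simp: cycle_def apath_def awalk_Cons_iff)
  then show thesis
    using that by simp
qed

lemma bifurcation_two_arcs:
  assumes "e \<in> arcs G" "f \<in> arcs G" "tail G e = tail G f" "e \<noteq> f"
  shows "bifurcation G (tail G f)"
proof (cases "finite (out_arcs G (tail G f))")
  case True
  have "card {e, f} \<le> card (out_arcs G (tail G f))"
    using assms by (intro card_mono[OF True]) (auto simp: out_arcs_def)
  then show ?thesis
    using assms by (auto simp: bifurcation_def)
qed (use assms in \<open>auto simp: bifurcation_def\<close>)

lemma bifurcation_other_arc:
  assumes "bifurcation G v"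
  obtains e where "e \<in> arcs G" "tail G e = v" "e \<noteq> f"
proof -
  have "\<not> out_arcs G v \<subseteq> {f}"
  proof
    assume *: "out_arcs G v \<subseteq> {f}"
    then have "card (out_arcs G v) \<le> card {f}"
      by (intro card_mono) auto
    with * assms show False
      by (auto simp: bifurcation_def dest: finite_subset)
  qed
  then show thesis
    using that by (auto simp: out_arcs_def)
qed

text \<open>A cycle in the tree has no exit, since an exit would make one of its vertices a
  bifurcation in the tree. If there is no cycle, \<open>u\<close> itself is a line point.\<close>

lemma no_bifurcations_reaches:
  assumes u: "u \<in> verts G" and none: "\<And>w. w \<in> vertex_tree G u \<Longrightarrow> \<not> bifurcation G w"
  shows "\<exists>w \<in> vertex_tree G u. w \<in> P_l G \<union> P_c G"
proof (cases "\<exists>w c. w \<in> vertex_tree G u \<and> cycle c \<and> w \<in> cycle_verts G c")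
  case True
  then obtain w c where w: "w \<in> vertex_tree G u" "cycle c" "w \<in> cycle_verts G c"
    by blast
  have c: "set c \<subseteq> arcs G"
    using w(2) by (auto simp: cycle_def)
  have "\<not> cycle_exit G c e" for e
  proof
    assume "cycle_exit G c e"
    then obtain f where f: "e \<in> arcs G" "f \<in> set c" "tail G e = tail G f" "e \<noteq> f"
      by (auto simp: cycle_exit_def)
    have "tail G f \<in> vertex_tree G u"
      using cycle_verts_awalk[OF w(2,3)] f(2) vertex_tree_subset[OF w(1)]
      by (auto simp: cycle_verts_def)
    then show False
      using none bifurcation_two_arcs[of e f] f c by auto
  qed
  with w show ?thesis
    by (auto simp: P_c_def)
next
  case False
  with u none have "u \<in> P_l G"
    by (auto simp: P_l_def)
  with u show ?thesis
    using vertex_tree_refl by blast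
qed

text \<open>An edge at \<open>b\<close> and a walk from its range back to \<open>b\<close> give a
  cycle through \<open>b\<close>. A second edge at \<open>b\<close> is an exit, and every path that
  starts on the cycle can be continued to \<open>b\<close>.\<close>

lemma recurrent_bifurcation_extreme:
  assumes b: "bifurcation G b" and ret: "\<And>w. w \<in> vertex_tree G b \<Longrightarrow> b \<in> vertex_tree G w"
  shows "b \<in> P_ec G"
proof -
  obtain e where e: "e \<in> arcs G" "tail G e = b"
    using bifurcation_other_arc[OF b] by metis
  have "head G e \<in> vertex_tree G b"
    using e by (auto simp: vertex_tree_iff awalk_simps intro!: exI[of _ "[e]"])
  from ret[OF this] obtain c where c: "cycle c" "e \<in> set c"
    using closed_walk_cycle e by metis
  have bc: "b \<in> cycle_verts G c"
    using c(2) e by (auto simp: cycle_verts_def)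
  obtain f where "f \<in> arcs G" "tail G f = b" "f \<noteq> e"
    using bifurcation_other_arc[OF b] by metis
  then have "cycle_exit G c f"
    using c(2) e by (metis cycle_exit_def)
  moreover have "\<exists>q z. awalk w q z \<and> z \<in> cycle_verts G c"
    if "u \<in> cycle_verts G c" "awalk u p w" for u p w
  proof -
    have "w \<in> vertex_tree G b"
      using subsetD[OF vertex_tree_subset[OF cycle_verts_awalk[OF c(1) bc that(1)]], of w] that(2)
      by (auto simp: vertex_tree_iff)
    from ret[OF this] bc show ?thesis
      by (auto simp: vertex_tree_iff)
  qed
  ultimately have "extreme_cycle G c"
    using c(1) by (auto simp: extreme_cycle_def)
  with bc show ?thesis
    by (auto simp: P_ec_def)
qed

lemma finite_bifurcations_reaches:
  assumes "v \<in> verts G" "finite {u \<in> vertex_tree G v. bifurcation G u}"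
  shows "\<exists>w \<in> vertex_tree G v. w \<in> P_l G \<union> P_c G \<union> P_ec G"
  using assms
proof (induction "card {u \<in> vertex_tree G v. bifurcation G u}" arbitrary: v rule: less_induct)
  case less
  let ?B = "\<lambda>v. {u \<in> vertex_tree G v. bifurcation G u}"
  consider (none) "?B v = {}"
    | (smaller) w where "w \<in> vertex_tree G v" "?B w \<noteq> ?B v"
    | (const) b where "b \<in> ?B v" "\<And>w. w \<in> vertex_tree G v \<Longrightarrow> ?B w = ?B v"
    by blast
  then show ?case
  proof cases
    case none
    then show ?thesis
      using no_bifurcations_reaches[of v] less.prems by blast
  next
    case smaller
    have sub: "?B w \<subset> ?B v"
      using smaller vertex_tree_subset[OF smaller(1)] by blast
    have "w \<in> verts G"
      using smaller(1) by (simp add: vertex_tree_def)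
    moreover have "card (?B w) < card (?B v)" "finite (?B w)"
      using sub less.prems(2) by (auto intro: psubset_card_mono finite_subset)
    ultimately have "\<exists>x \<in> vertex_tree G w. x \<in> P_l G \<union> P_c G \<union> P_ec G"
      using less.hyps by blast
    then show ?thesis
      using vertex_tree_subset[OF smaller(1)] by blast
  next
    case const
    \<comment> \<open>If \<open>b\<close> reaches \<open>w\<close>, then \<open>w\<close> lies in
      the tree of \<open>v\<close> and sees the same bifurcations as \<open>v\<close>, among them
      \<open>b\<close>. So \<open>b\<close> is recurrent.\<close>
    then have "b \<in> P_ec G"
      by (intro recurrent_bifurcation_extreme) (use vertex_tree_subset[of b v] in blast)+
    with const(1) show ?thesis
      by blast
  qed
qed

lemma reaches_distinguished:
  assumes "v \<in> verts G"
  obtains w p where "awalk v p w" "w \<in> P_l G \<union> P_c G \<union> P_ec G \<union> P_binf G"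
proof -
  \<comment> \<open>Inside \<open>P_binf\<close> the vertex \<open>v\<close> itself serves; outside
    it, the tree has only finitely many bifurcations.\<close>
  have "\<exists>w \<in> vertex_tree G v. w \<in> P_l G \<union> P_c G \<union> P_ec G \<union> P_binf G"
    using finite_bifurcations_reaches[OF assms] vertex_tree_refl[OF assms] assms
    by (cases "v \<in> P_binf G") (auto simp: P_binf_def)
  with that show thesis
    by (auto simp: vertex_tree_iff)
qed

lemma distinguished_verts: "P_l G \<union> P_c G \<union> P_ec G \<union> P_binf G \<subseteq> verts G"
proof -
  have "cycle_verts G c \<subseteq> verts G" if "cycle c" for c
  proof -
    have "set c \<subseteq> arcs G"
      using that by (auto simp: cycle_def)
    then show ?thesis
      by (auto simp: cycle_verts_def)
  qed
  then show ?thesis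
    by (auto simp: P_l_def P_c_def P_ec_def P_binf_def extreme_cycle_def)
qed

end

section \<open>Finite sums in rings without unit\<close>

context nonunital_ring
begin

abbreviation carrier where "carrier \<equiv> rng_carrier R"
abbreviation zero (\<open>\<zero>\<close>) where "\<zero> \<equiv> rng_zero R"
abbreviation add (infixl \<open>\<oplus>\<close> 65) where "x \<oplus> y \<equiv> rng_add R x y"
abbreviation mult (infixl \<open>\<otimes>\<close> 70) where "x \<otimes> y \<equiv> rng_mult R x y"

lemmas closed [simp, intro] = zero_closed add_closed uminus_closed mult_closed

lemma add_zero_right [simp]: "x \<in> carrier \<Longrightarrow> x \<oplus> \<zero> = x"
  using add_commute add_zero by simp

declare add_zero [simp]

lemma add_left_commute:
  "x \<in> carrier \<Longrightarrow> y \<in> carrier \<Longrightarrow> z \<in> carrier \<Longrightarrow> x \<oplus> (y \<oplus> z) = y \<oplus> (x \<oplus> z)"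
  by (metis add_assoc add_commute)

text \<open>Products and scalar multiples involving zero vanish by this: distributivity makes them
  equal to their own double.\<close>

lemma add_idem_zero:
  assumes "x \<in> carrier" "x \<oplus> x = x"
  shows "x = \<zero>"
  using assms by (metis add_assoc add_uminus add_zero uminus_closed)

lemma mult_zero_left [simp]: "x \<in> carrier \<Longrightarrow> \<zero> \<otimes> x = \<zero>"
  by (rule add_idem_zero) (simp_all flip: distrib_right)

lemma mult_zero_right [simp]: "x \<in> carrier \<Longrightarrow> x \<otimes> \<zero> = \<zero>"
  by (rule add_idem_zero) (simp_all flip: distrib_left)

definition lsum :: "'r list \<Rightarrow> 'r" where
  "lsum xs = foldr (\<oplus>) xs \<zero>"

lemma lsum_Nil [simp]: "lsum [] = \<zero>"
  and lsum_Cons [simp]: "lsum (x # xs) = x \<oplus> lsum xs"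
  by (simp_all add: lsum_def)

lemma lsum_closed [simp, intro]: "set xs \<subseteq> carrier \<Longrightarrow> lsum xs \<in> carrier"
  by (induction xs) auto

lemma lsum_append:
  "set xs \<subseteq> carrier \<Longrightarrow> set ys \<subseteq> carrier \<Longrightarrow> lsum (xs @ ys) = lsum xs \<oplus> lsum ys"
  by (induction xs) (auto simp: add_assoc)

lemma lsum_mult_left:
  "x \<in> carrier \<Longrightarrow> f ` set ys \<subseteq> carrier \<Longrightarrow> x \<otimes> lsum (map f ys) = lsum (map (\<lambda>y. x \<otimes> f y) ys)"
  by (induction ys) (auto simp: distrib_left image_subset_iff)

lemma lsum_mult_right:
  "x \<in> carrier \<Longrightarrow> f ` set ys \<subseteq> carrier \<Longrightarrow> lsum (map f ys) \<otimes> x = lsum (map (\<lambda>y. f y \<otimes> x) ys)"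
  by (induction ys) (auto simp: distrib_right image_subset_iff)

lemma lsum_zero: "(\<And>y. y \<in> set ys \<Longrightarrow> f y = \<zero>) \<Longrightarrow> lsum (map f ys) = \<zero>"
  by (induction ys) auto

lemma lsum_concat:
  "f ` \<Union>(set ` set xss) \<subseteq> carrier \<Longrightarrow>
     lsum (map f (concat xss)) = lsum (map (\<lambda>xs. lsum (map f xs)) xss)"
  by (induction xss) (simp_all add: lsum_append image_Un image_subset_iff)

lemma lsum_partition:
  "f ` set xs \<subseteq> carrier \<Longrightarrow>
     lsum (map f xs) = lsum (map f (filter P xs)) \<oplus> lsum (map f (filter (\<lambda>x. \<not> P x) xs))"
proof (induction xs)
  case (Cons x xs)
  have "lsum (map f (filter P xs)) \<in> carrier" "lsum (map f (filter (\<lambda>x. \<not> P x) xs)) \<in> carrier"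
    using Cons.prems by (auto simp: image_subset_iff intro!: lsum_closed)
  with Cons show ?case
    by (auto simp: add_assoc intro: add_left_commute)
qed simp

text \<open>Used contrapositively, to find a fibre of \<open>g\<close> with nonzero sum in a nonzero
  sum. The induction splits off the whole fibre of the first entry.\<close>

lemma lsum_fibres_zero:
  assumes "f ` set xs \<subseteq> carrier" "\<And>k. lsum (map f (filter (\<lambda>x. g x = k) xs)) = \<zero>"
  shows "lsum (map f xs) = \<zero>"
  using assms
proof (induction "length xs" arbitrary: xs rule: less_induct)
  case less
  show ?case
  proof (cases xs)
    case (Cons a as)
    let ?ys = "filter (\<lambda>x. g x \<noteq> g a) xs"
    have "filter (\<lambda>x. g x = k) ?ys = (if k = g a then [] else filter (\<lambda>x. g x = k) xs)" for k
      by (auto simp: filter_empty_conv intro!: filter_cong)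
    then have fibres: "lsum (map f (filter (\<lambda>x. g x = k) ?ys)) = \<zero>" for k
      using less.prems(2)[of k] by simp
    have "length ?ys < length xs"
      using Cons by (auto intro!: le_imp_less_Suc)
    moreover have "f ` set ?ys \<subseteq> carrier"
      using less.prems(1) by auto
    ultimately have "lsum (map f ?ys) = \<zero>"
      using fibres by (rule less.hyps)
    then show ?thesis
      using lsum_partition[OF less.prems(1), of "\<lambda>x. g x = g a"] less.prems(2)[of "g a"] by simp
  qed simp
qed

end

context nonunital_algebra
begin

abbreviation scale (infixr \<open>\<odot>\<close> 75) where "a \<odot> x \<equiv> rng_scale R a x"

declare scale_closed [simp, intro] scale_one [simp]

lemma scale_zero_left [simp]: "x \<in> carrier \<Longrightarrow> 0 \<odot> x = \<zero>"
  by (rule add_idem_zero) (simp_all flip: scale_add_left)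

lemma scale_zero_right [simp]: "a \<odot> \<zero> = \<zero>"
  by (rule add_idem_zero) (simp_all flip: scale_add_right)

lemma uminus_scale: "x \<in> carrier \<Longrightarrow> rng_uminus R x = (- 1) \<odot> x"
proof -
  assume x: "x \<in> carrier"
  have "(- 1) \<odot> x \<oplus> x = (- 1 + 1) \<odot> x"
    using x by (simp only: scale_add_left) simp
  then have "(- 1) \<odot> x \<oplus> x = \<zero>"
    using x by simp
  then show ?thesis
    using x by (metis add_assoc add_commute add_uminus add_zero scale_closed uminus_closed)
qed

lemma lsum_scale:
  "f ` set ys \<subseteq> carrier \<Longrightarrow> a \<odot> lsum (map f ys) = lsum (map (\<lambda>y. a \<odot> f y) ys)"
  by (induction ys) (auto simp: scale_add_right image_subset_iff)

lemma lsum_scale_const: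
  "x \<in> carrier \<Longrightarrow> lsum (map (\<lambda>y. c y \<odot> x) ys) = sum_list (map c ys) \<odot> x"
  by (induction ys) (auto simp: scale_add_left)

end

section \<open>Generated ideals\<close>

text \<open>Guarantees that the intersection in \<open>rng_ideal_generated\<close> is over a
  nonempty family and stays inside the carrier.\<close>

lemma rng_ideal_carrier: "nonunital_ring R \<Longrightarrow> rng_ideal R (rng_carrier R)"
  by (auto simp: rng_ideal_def rng_left_ideal_def nonunital_ring_def)

lemma rng_ideal_generated_ideal:
  assumes "nonunital_ring R" "X \<subseteq> rng_carrier R"
  shows "rng_ideal R (rng_ideal_generated R X)"
proof -
  have "rng_ideal_generated R X \<subseteq> rng_carrier R"
    using assms rng_ideal_carrier by (auto simp: rng_ideal_generated_def)
  then show ?thesis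
    unfolding rng_ideal_def rng_left_ideal_def
    by (auto simp: rng_ideal_generated_def rng_ideal_def rng_left_ideal_def)
qed

lemma rng_ideal_generated_superset: "X \<subseteq> rng_ideal_generated R X"
  by (auto simp: rng_ideal_generated_def)

text \<open>An \<open>a\<close> chosen in the ideal itself settles the second half of density,
  because \<open>a y\<close> then lies in the ideal for every \<open>y\<close>.\<close>

lemma dense_ideal_if_no_annihilator:
  assumes "rng_ideal R I"
    and "\<And>x. x \<in> rng_carrier R \<Longrightarrow> x \<noteq> rng_zero R \<Longrightarrow> \<exists>a \<in> I. rng_mult R a x \<noteq> rng_zero R"
  shows "dense_ideal R I"
  unfolding dense_ideal_def dense_left_ideal_def
proof (intro conjI ballI impI)
  have I: "rng_left_ideal R I" "I \<subseteq> rng_carrier R"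
    "\<And>a x. a \<in> rng_carrier R \<Longrightarrow> x \<in> I \<Longrightarrow> rng_mult R x a \<in> I"
    using assms(1) by (auto simp: rng_ideal_def rng_left_ideal_def)
  show "rng_ideal R I" "rng_left_ideal R I"
    by (fact assms(1) I(1))+
  fix x y
  assume "x \<in> rng_carrier R" "y \<in> rng_carrier R" "x \<noteq> rng_zero R"
  with assms(2)[of x] I(2,3)
  show "\<exists>a \<in> rng_carrier R. rng_mult R a x \<noteq> rng_zero R \<and> rng_mult R a y \<in> I"
    by (meson subsetD)
qed

section \<open>Paths and ghost paths in the Leavitt path algebra\<close>

text \<open>
  \<open>(k, u, l, v, m)\<close> stands for \<open>k l m\<^sup>*\<close>, where \<open>l\<close> is a path from \<open>u\<close> and \<open>m\<close> a path from \<open>v\<close>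
  with the same range; the vertices are needed for paths of length 0.
\<close>

type_synonym ('k, 'a, 'b) monomial = "'k \<times> 'a \<times> 'b list \<times> 'a \<times> 'b list"

text \<open>The algebra is a parameter with a defining equation, so that the notation of
  \<open>nonunital_algebra\<close> applies while the quotient construction stays folded.\<close>

locale lpa = wf_digraph G + nonunital_algebra R
  for G :: "('a, 'b) pre_digraph"
    and R :: "('k::field, ('k, 'a, 'b) lpa_term set) rng_algebra" +
  assumes R_def: "R = leavitt_path_algebra G"
begin

abbreviation vertex where "vertex v \<equiv> lpa_class G (Vertex v) :: ('k, 'a, 'b) lpa_term set"
abbreviation edge where "edge e \<equiv> lpa_class G (Edge e) :: ('k, 'a, 'b) lpa_term set"
abbreviation ghost where "ghost e \<equiv> lpa_class G (Ghost e) :: ('k, 'a, 'b) lpa_term set"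

declare awalk_hd_in_verts [simp] awalk_last_in_verts [simp]

text \<open>
  The elements of the algebra are sets of terms; without this, \<open>auto\<close> would split an equation in
  the algebra into two inclusions.
\<close>

declare subset_antisym [rule del]

lemma class_simps:
  "t \<in> lpa_terms G \<Longrightarrow> lpa_class G t \<in> carrier"
  "\<zero> = lpa_class G Zero"
  "s \<in> lpa_terms G \<Longrightarrow> t \<in> lpa_terms G \<Longrightarrow> lpa_class G s \<oplus> lpa_class G t = lpa_class G (Add s t)"
  "s \<in> lpa_terms G \<Longrightarrow> t \<in> lpa_terms G \<Longrightarrow> lpa_class G s \<otimes> lpa_class G t = lpa_class G (Mult s t)"
  "t \<in> lpa_terms G \<Longrightarrow> rng_uminus R (lpa_class G t) = lpa_class G (Neg t)"
  "t \<in> lpa_terms G \<Longrightarrow> a \<odot> lpa_class G t = lpa_class G (Scale a t)"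
  by (simp_all add: R_def lpa_carrier lpa_zero lpa_add lpa_mult lpa_uminus lpa_scale)

lemma carrierE:
  assumes "x \<in> carrier"
  obtains t where "t \<in> lpa_terms G" "x = lpa_class G t"
  using assms by (auto simp: R_def lpa_carrier)

lemma generators_closed [simp, intro]:
  "v \<in> verts G \<Longrightarrow> vertex v \<in> carrier"
  "e \<in> arcs G \<Longrightarrow> edge e \<in> carrier"
  "e \<in> arcs G \<Longrightarrow> ghost e \<in> carrier"
  by (simp_all add: class_simps)

lemma relations:
  "v \<in> verts G \<Longrightarrow> vertex v \<otimes> vertex v = vertex v"
  "v \<in> verts G \<Longrightarrow> w \<in> verts G \<Longrightarrow> v \<noteq> w \<Longrightarrow> vertex v \<otimes> vertex w = \<zero>"
  "e \<in> arcs G \<Longrightarrow> vertex (tail G e) \<otimes> edge e = edge e"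
  "e \<in> arcs G \<Longrightarrow> edge e \<otimes> vertex (head G e) = edge e"
  "e \<in> arcs G \<Longrightarrow> vertex (head G e) \<otimes> ghost e = ghost e"
  "e \<in> arcs G \<Longrightarrow> ghost e \<otimes> vertex (tail G e) = ghost e"
  "e \<in> arcs G \<Longrightarrow> ghost e \<otimes> edge e = vertex (head G e)"
  "e \<in> arcs G \<Longrightarrow> f \<in> arcs G \<Longrightarrow> e \<noteq> f \<Longrightarrow> ghost e \<otimes> edge f = \<zero>"
  by (simp_all add: class_simps lpa_class_eqI lpa_cong.Vertex_idem lpa_cong.Vertex_orth
      lpa_cong.source_Edge lpa_cong.Edge_range lpa_cong.range_Ghost lpa_cong.Ghost_source
      lpa_cong.CK1_same lpa_cong.CK1_diff)

lemma vertex_regular: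
  assumes "regular_vertex G v"
  obtains es where "set es = out_arcs G v" "vertex v = lsum (map (\<lambda>e. edge e \<otimes> ghost e) es)"
proof -
  obtain es where es: "set es = out_arcs G v" "distinct es"
    using assms finite_distinct_list by (auto simp: regular_vertex_def)
  have "(foldr (\<lambda>e t. Add (Mult (Edge e) (Ghost e)) t) es Zero :: ('k, 'a, 'b) lpa_term) \<in> lpa_terms G \<and>
      lsum (map (\<lambda>e. edge e \<otimes> ghost e) es) =
      lpa_class G (foldr (\<lambda>e t. Add (Mult (Edge e) (Ghost e)) t) es Zero)" if "set es \<subseteq> arcs G" for es
    using that by (induction es) (auto simp: class_simps)
  with es that[OF es(1)] lpa_class_eqI[OF lpa_cong.CK2[OF assms es(2,1)]] show thesis
    by (auto simp: out_arcs_def)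
qed

fun path :: "'a \<Rightarrow> 'b list \<Rightarrow> ('k, 'a, 'b) lpa_term set" where
  "path u [] = vertex u"
| "path u (e # p) = edge e \<otimes> path (head G e) p"

text \<open>The image of \<open>path u p\<close> under the involution of the algebra: the factors
  are reversed, and \<open>u\<close> is now the vertex on the right.\<close>

fun ghost_path :: "'a \<Rightarrow> 'b list \<Rightarrow> ('k, 'a, 'b) lpa_term set" where
  "ghost_path u [] = vertex u"
| "ghost_path u (e # p) = ghost_path (head G e) p \<otimes> ghost e"

lemma path_closed [simp, intro]: "awalk u p w \<Longrightarrow> path u p \<in> carrier"
  by (induction p arbitrary: u) (auto simp: awalk_simps)

lemma ghost_path_closed [simp, intro]: "awalk u p w \<Longrightarrow> ghost_path u p \<in> carrier"
  by (induction p arbitrary: u) (auto simp: awalk_simps)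

lemma vertex_path: "awalk u p w \<Longrightarrow> vertex u \<otimes> path u p = path u p"
  by (cases p) (auto simp: awalk_simps relations simp flip: mult_assoc)

lemma path_vertex: "awalk u p w \<Longrightarrow> path u p \<otimes> vertex w = path u p"
  by (induction p arbitrary: u) (auto simp: awalk_simps relations mult_assoc)

lemma vertex_ghost_path: "awalk u p w \<Longrightarrow> vertex w \<otimes> ghost_path u p = ghost_path u p"
  by (induction p arbitrary: u) (auto simp: awalk_simps relations simp flip: mult_assoc)

lemma ghost_path_vertex: "awalk u p w \<Longrightarrow> ghost_path u p \<otimes> vertex u = ghost_path u p"
  by (cases p) (auto simp: awalk_simps relations mult_assoc)

lemma path_append:
  "awalk u p w \<Longrightarrow> awalk w q z \<Longrightarrow> path u (p @ q) = path u p \<otimes> path w q"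
  by (induction p arbitrary: u) (auto simp: awalk_simps mult_assoc vertex_path)

lemma ghost_path_snoc:
  "awalk u p (tail G e) \<Longrightarrow> e \<in> arcs G \<Longrightarrow> ghost_path u (p @ [e]) = ghost e \<otimes> ghost_path u p"
  by (induction p arbitrary: u) (auto simp: awalk_simps mult_assoc relations)

fun monom :: "('k, 'a, 'b) monomial \<Rightarrow> ('k, 'a, 'b) lpa_term set" where
  "monom (k, u, l, v, m) = k \<odot> (path u l \<otimes> ghost_path v m)"

text \<open>The parameter is the vertex that fixes the monomial from the right. Monomials are
  grouped by it because they are later multiplied on the right by edges leaving it.\<close>

fun wf_monom :: "'a \<Rightarrow> ('k, 'a, 'b) monomial \<Rightarrow> bool" where
  "wf_monom v' (k, u, l, v, m) \<longleftrightarrow> v = v' \<and> (\<exists>w. awalk u l w \<and> awalk v m w)"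

fun ghost_part :: "('k, 'a, 'b) monomial \<Rightarrow> 'b list" where
  "ghost_part (k, u, l, v, m) = m"

lemma monom_closed [simp, intro]: "wf_monom v it \<Longrightarrow> monom it \<in> carrier"
  by (cases it) auto

lemma monom_vertex: "wf_monom v it \<Longrightarrow> monom it \<otimes> vertex v = monom it"
  by (cases it)
    (auto simp: mult_scale_left mult_assoc ghost_path_vertex awalk_hd_in_verts)

section \<open>Monomials span the algebra\<close>

definition spanned where
  "spanned x \<longleftrightarrow> (\<exists>its. (\<forall>it \<in> set its. \<exists>v. wf_monom v it) \<and> x = lsum (map monom its))"

lemma monoms_closed: "\<forall>it \<in> set its. \<exists>v. wf_monom v it \<Longrightarrow> monom ` set its \<subseteq> carrier"
  using monom_closed by blast

lemma spanned_closed: "spanned x \<Longrightarrow> x \<in> carrier"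
  unfolding spanned_def using monoms_closed by (metis list.set_map lsum_closed)

lemma spanned_monom: "wf_monom v it \<Longrightarrow> spanned (monom it)"
  unfolding spanned_def by (intro exI[of _ "[it]"]) auto

lemma spanned_zero: "spanned \<zero>"
  unfolding spanned_def by (intro exI[of _ "[]"]) auto

lemma spanned_add:
  assumes "spanned x" "spanned y"
  shows "spanned (x \<oplus> y)"
proof -
  obtain its jts where its: "\<forall>it \<in> set its. \<exists>v. wf_monom v it" "x = lsum (map monom its)"
    and jts: "\<forall>it \<in> set jts. \<exists>v. wf_monom v it" "y = lsum (map monom jts)"
    using assms unfolding spanned_def by blast
  have "x \<oplus> y = lsum (map monom (its @ jts))"
    using its(2) jts(2) monoms_closed[OF its(1)] monoms_closed[OF jts(1)] by (simp add: lsum_append)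
  moreover have "\<forall>it \<in> set (its @ jts). \<exists>v. wf_monom v it"
    using its(1) jts(1) by (simp only: set_append ball_Un)
  ultimately show ?thesis
    unfolding spanned_def by blast
qed

lemma spanned_lsum: "(\<And>it. it \<in> set its \<Longrightarrow> spanned (f it)) \<Longrightarrow> spanned (lsum (map f its))"
  by (induction its) (auto simp: spanned_zero spanned_add)

lemma spanned_scale:
  assumes "spanned x"
  shows "spanned (a \<odot> x)"
proof -
  obtain its where its: "\<forall>it \<in> set its. \<exists>v. wf_monom v it" "x = lsum (map monom its)"
    using assms unfolding spanned_def by blast
  have "spanned (a \<odot> monom it)" if it: "wf_monom v it" for v it
  proof -
    obtain k u l m where [simp]: "it = (k, u, l, v, m)"
      using it by (cases it) auto
    have "a \<odot> monom it = monom (a * k, u, l, v, m)"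
      using it by (auto simp: scale_scale)
    with it show ?thesis
      using spanned_monom[of v "(a * k, u, l, v, m)"] by simp
  qed
  then have "spanned (lsum (map (\<lambda>it. a \<odot> monom it) its))"
    using its(1) by (blast intro: spanned_lsum)
  then show ?thesis
    using monoms_closed[OF its(1)] by (simp add: its(2) lsum_scale)
qed

text \<open>Each product of a generator with a monomial is a monomial or zero: an edge lengthens the
  real path, and a ghost edge cancels the first real edge or, if there is none, lengthens the ghost
  path. Mismatched vertices give zero by orthogonality.\<close>

lemma spanned_generator_mult:
  assumes x: "spanned x"
    and g: "g \<in> vertex ` verts G \<union> edge ` arcs G \<union> ghost ` arcs G"
  shows "spanned (g \<otimes> x)"
proof -
  obtain its where its: "\<forall>it \<in> set its. \<exists>v. wf_monom v it" "x = lsum (map monom its)"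
    using x unfolding spanned_def by blast
  have [simp]: "g \<in> carrier"
    using g by auto
  have path: "spanned (k \<odot> (path u l \<otimes> ghost_path v m))" if "awalk u l w" "awalk v m w" for k u l v m w
    using spanned_monom[of v "(k, u, l, v, m)"] that by auto
  have "spanned (g \<otimes> path u l \<otimes> ghost_path v m)" if *: "awalk u l w" "awalk v m w" for u l v m w
  proof -
    have u: "u \<in> verts G" and w: "w \<in> verts G"
      using * awalk_hd_in_verts awalk_last_in_verts by blast+
    have expand: "g \<otimes> path u l \<otimes> ghost_path v m = g \<otimes> vertex u \<otimes> path u l \<otimes> ghost_path v m"
      using * u by (simp add: mult_assoc vertex_path)
    from g consider (vertex) z where "z \<in> verts G" "g = vertex z" | (edge) e where "e \<in> arcs G" "g = edge e"
      | (ghost) e where "e \<in> arcs G" "g = ghost e"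
      by blast
    then show ?thesis
    proof cases
      case vertex
      then show ?thesis
        using path[OF *, of 1] * u expand
        by (cases "z = u") (auto simp: relations spanned_zero vertex_path)
    next
      case edge
      show ?thesis
      proof (cases "head G e = u")
        case True
        with edge path[of "tail G e" "e # l" w v m 1] * show ?thesis
          by (auto simp: awalk_simps)
      next
        case False
        have "g \<otimes> vertex u = g \<otimes> vertex (head G e) \<otimes> vertex u"
          using edge by (simp only: relations)
        also have "\<dots> = g \<otimes> (vertex (head G e) \<otimes> vertex u)"
          using edge u by (intro mult_assoc) auto
        also have "\<dots> = \<zero>"
          using False edge u by (simp add: relations)
        finally show ?thesis
          using expand * by (auto simp: spanned_zero)
      qed
    next
      case ghost
      show ?thesis
      proof (cases l)
        case Nil
        then have [simp]: "u = w"
          using * by (simp add: awalk_simps)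
        show ?thesis
        proof (cases "tail G e = w")
          case True
          \<comment> \<open>Ghost factors appear in reverse order, so a new leftmost factor is a new
            last edge of \<open>m\<close>.\<close>
          have ext: "awalk v (m @ [e]) (head G e)"
            using * ghost True by (auto simp: awalk_simps)
          have "g \<otimes> path u l \<otimes> ghost_path v m = ghost_path v (m @ [e])"
            using ghost * relations(6)[of e] ghost_path_snoc[of v m e] by (simp add: Nil True)
          also have "\<dots> = 1 \<odot> (path (head G e) [] \<otimes> ghost_path v (m @ [e]))"
            using vertex_ghost_path[OF ext] ghost_path_closed[OF ext] by simp
          finally have eq: "g \<otimes> path u l \<otimes> ghost_path v m =
            1 \<odot> (path (head G e) [] \<otimes> ghost_path v (m @ [e]))" .
          show ?thesis
            unfolding eq by (rule path[OF _ ext]) (use ghost in \<open>simp add: awalk_simps\<close>)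
        next
          case False
          have "g \<otimes> vertex w = g \<otimes> vertex (tail G e) \<otimes> vertex w"
            using ghost by (simp only: relations)
          also have "\<dots> = g \<otimes> (vertex (tail G e) \<otimes> vertex w)"
            using ghost w by (intro mult_assoc) auto
          also have "\<dots> = \<zero>"
            using False ghost w by (simp add: relations)
          finally show ?thesis
            using * by (auto simp: Nil spanned_zero)
        qed
      next
        case (Cons f l')
        with * have f: "f \<in> arcs G" "awalk (head G f) l' w"
          by (auto simp: awalk_simps)
        have "g \<otimes> path u l = (ghost e \<otimes> edge f) \<otimes> path (head G f) l'"
          using ghost f by (simp add: Cons mult_assoc)
        also have "\<dots> = (if e = f then path (head G f) l' else \<zero>)"
          using ghost f by (auto simp: relations vertex_path)
        finally show ?thesis
          using path[OF f(2) *(2), of 1] f * by (auto simp: spanned_zero)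
      qed
    qed
  qed
  then have "spanned (g \<otimes> monom it)" if "wf_monom v it" for v it
    using that by (cases it) (auto simp: mult_scale_right mult_assoc intro!: spanned_scale)
  then have "spanned (lsum (map (\<lambda>it. g \<otimes> monom it) its))"
    using its(1) by (blast intro: spanned_lsum)
  then show ?thesis
    using monoms_closed[OF its(1)] by (simp add: its(2) lsum_mult_left)
qed

text \<open>This avoids multiplying two monomials: the left factor is taken apart into generators.
  The induction keeps \<open>x\<close> arbitrary because a product \<open>s t\<close> acts by
  \<open>s\<close> on \<open>t x\<close>.\<close>

lemma spanned_term_mult: "t \<in> lpa_terms G \<Longrightarrow> spanned x \<Longrightarrow> spanned (lpa_class G t \<otimes> x)"
proof (induction t arbitrary: x)
  case (Zero x)
  then show ?case
    by (auto simp: spanned_closed spanned_zero simp flip: class_simps(2))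
next
  case (Add s t)
  then show ?case
    by (simp add: spanned_add distrib_right spanned_closed class_simps(1) flip: class_simps(3))
next
  case (Neg t)
  then show ?case
    by (simp add: spanned_scale mult_scale_left uminus_scale spanned_closed class_simps(1)
        flip: class_simps(5))
next
  case (Mult s t)
  then show ?case
    by (simp add: mult_assoc spanned_closed class_simps(1) flip: class_simps(4))
next
  case (Scale a t)
  then show ?case
    by (simp add: spanned_scale mult_scale_left spanned_closed class_simps(1) flip: class_simps(6))
qed (auto intro!: spanned_generator_mult)

lemma spanned_class: "t \<in> lpa_terms G \<Longrightarrow> spanned (lpa_class G t)"
proof (induction t)
  case (Vertex v)
  then show ?case
    using spanned_monom[of v "(1, v, [], v, [])"] by (simp add: awalk_simps relations)
next
  case (Edge e)
  then show ?case
    using spanned_monom[of "head G e" "(1, tail G e, [e], head G e, [])"]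
    by (simp add: awalk_simps relations mult_assoc)
next
  case (Ghost e)
  then show ?case
    using spanned_monom[of "tail G e" "(1, head G e, [], tail G e, [e])"]
    by (simp add: awalk_simps relations)
next
  case Zero
  then show ?case
    by (simp add: spanned_zero flip: class_simps(2))
next
  case (Add s t)
  then show ?case
    by (simp add: spanned_add flip: class_simps(3))
next
  case (Neg t)
  then show ?case
    by (simp add: spanned_scale uminus_scale class_simps(1) flip: class_simps(5))
next
  case (Mult s t)
  then show ?case
    by (simp add: spanned_term_mult flip: class_simps(4))
next
  case (Scale a t)
  then show ?case
    by (simp add: spanned_scale flip: class_simps(6))
qed

lemma spanned: "x \<in> carrier \<Longrightarrow> spanned x"
  by (erule carrierE) (simp add: spanned_class)

end

section \<open>A representation on boundary paths\<close>

text \<open>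
  A boundary path is infinite or ends in a singular vertex; in the latter case it is padded with
  \<open>Inl v\<close>, so that boundary paths become infinite sequences in all cases. The algebra acts on
  functions of an integer and a boundary path, where the integer records the degree. This degree
  separates paths of different lengths, which boundary paths alone do not (an infinite path may be
  periodic).
\<close>

primrec seq_source :: "('a, 'b) pre_digraph \<Rightarrow> 'a + 'b \<Rightarrow> 'a" where
  "seq_source G (Inl v) = v"
| "seq_source G (Inr e) = tail G e"

definition boundary_path :: "('a, 'b) pre_digraph \<Rightarrow> (nat \<Rightarrow> 'a + 'b) \<Rightarrow> bool" where
  "boundary_path G p \<longleftrightarrow> (\<forall>n. case p n of
     Inl v \<Rightarrow> v \<in> verts G \<and> \<not> regular_vertex G v \<and> p (Suc n) = Inl v
   | Inr e \<Rightarrow> e \<in> arcs G \<and> seq_source G (p (Suc n)) = head G e)"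

definition prefix_arc :: "'b \<Rightarrow> (nat \<Rightarrow> 'a + 'b) \<Rightarrow> nat \<Rightarrow> 'a + 'b" where
  "prefix_arc e p = case_nat (Inr e) p"

lemma prefix_arc_simps [simp]:
  "prefix_arc e p 0 = Inr e" "prefix_arc e p (Suc n) = p n"
  by (simp_all add: prefix_arc_def)

lemma prefix_arc_eq_iff [simp]: "prefix_arc e p = prefix_arc f q \<longleftrightarrow> e = f \<and> p = q"
  by (auto simp: prefix_arc_def fun_eq_iff split: nat.splits)

lemma eq_prefix_arc_iff: "q = prefix_arc e p \<longleftrightarrow> q 0 = Inr e \<and> (\<lambda>n. q (Suc n)) = p"
  by (auto simp: prefix_arc_def fun_eq_iff split: nat.splits)

lemma prefix_arc_tail: "q 0 = Inr e \<Longrightarrow> prefix_arc e (\<lambda>n. q (Suc n)) = q"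
  by (auto simp: prefix_arc_def fun_eq_iff split: nat.splits)

lemma boundary_path_prefix_arc [simp]:
  "boundary_path G (prefix_arc e p) \<longleftrightarrow>
     e \<in> arcs G \<and> seq_source G (p 0) = head G e \<and> boundary_path G p"
proof -
  have split: "(\<forall>n. P n) \<longleftrightarrow> P 0 \<and> (\<forall>n. P (Suc n))" for P :: "nat \<Rightarrow> bool"
    by (metis not0_implies_Suc)
  show ?thesis
    unfolding boundary_path_def by (subst split) (simp cong del: sum.case_cong_weak)
qed

lemma boundary_path_cases:
  assumes "boundary_path G q"
  obtains (singular) "seq_source G (q 0) \<in> verts G" "\<not> regular_vertex G (seq_source G (q 0))"
      "\<And>e. q 0 \<noteq> Inr e"
  | (arc) e p where "q = prefix_arc e p" "e \<in> arcs G" "seq_source G (p 0) = head G e"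
      "boundary_path G p"
proof (cases "q 0")
  case (Inl v)
  then show thesis
    using assms by (intro singular) (auto simp: boundary_path_def dest: spec[of _ 0])
next
  case (Inr e)
  then have q: "q = prefix_arc e (\<lambda>n. q (Suc n))"
    by (simp add: prefix_arc_tail)
  then have "boundary_path G (prefix_arc e (\<lambda>n. q (Suc n)))"
    using assms by simp
  with arc[OF q] show thesis
    by simp
qed

lemma (in wf_digraph) boundary_path_exists:
  assumes "v \<in> verts G"
  obtains p where "boundary_path G p" "seq_source G (p 0) = v"
proof -
  \<comment> \<open>Follow a chosen edge as long as the vertex is regular; at a sink or an infinite
    emitter, stop and pad.\<close>
  define out where
    "out u = (if regular_vertex G u then Inr (SOME e. e \<in> out_arcs G u) else Inl u)" for u
  define vs where "vs = rec_nat v (\<lambda>_ u. case out u of Inl u \<Rightarrow> u | Inr e \<Rightarrow> head G e)"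
  have out: "case out u of Inl w \<Rightarrow> w = u \<and> \<not> regular_vertex G u | Inr e \<Rightarrow> e \<in> out_arcs G u" for u
    using some_in_eq[of "out_arcs G u"] by (auto simp: out_def regular_vertex_def)
  have source [simp]: "seq_source G (out u) = u" for u
    using out[of u] by (auto split: sum.splits)
  have vs: "vs n \<in> verts G" for n
  proof (induction n)
    case (Suc n)
    then show ?case
      using out[of "vs n"] by (auto simp: vs_def split: sum.splits)
  qed (simp add: vs_def assms)
  have "boundary_path G (\<lambda>n. out (vs n))"
    unfolding boundary_path_def
  proof
    fix n
    show "case out (vs n) of Inl w \<Rightarrow> w \<in> verts G \<and> \<not> regular_vertex G w \<and> out (vs (Suc n)) = Inl w
      | Inr e \<Rightarrow> e \<in> arcs G \<and> seq_source G (out (vs (Suc n))) = head G e"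
      using out[of "vs n"] vs[of n] by (auto simp: vs_def split: sum.splits)
  qed
  moreover have "seq_source G (out (vs 0)) = v"
    by (simp add: vs_def)
  ultimately show thesis
    by (rule that)
qed

type_synonym ('k, 'a, 'b) boundary_fun = "int \<Rightarrow> (nat \<Rightarrow> 'a + 'b) \<Rightarrow> 'k"

text \<open>On point masses, an edge prepends itself and raises the degree by one, and a ghost edge
  undoes this; on function values the shifts are therefore reversed. The guards make generators
  vanish off boundary paths, without which CK2 would fail there.\<close>

primrec term_act :: "('a, 'b) pre_digraph \<Rightarrow> ('k::field, 'a, 'b) lpa_term \<Rightarrow>
    ('k, 'a, 'b) boundary_fun \<Rightarrow> ('k, 'a, 'b) boundary_fun" where
  "term_act G (Vertex v) f = (\<lambda>n q. if boundary_path G q \<and> seq_source G (q 0) = v then f n q else 0)"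
| "term_act G (Edge e) f =
     (\<lambda>n q. if boundary_path G q \<and> q 0 = Inr e then f (n - 1) (\<lambda>i. q (Suc i)) else 0)"
| "term_act G (Ghost e) f =
     (\<lambda>n q. if boundary_path G q \<and> seq_source G (q 0) = head G e then f (n + 1) (prefix_arc e q) else 0)"
| "term_act G Zero f = (\<lambda>n q. 0)"
| "term_act G (Add s t) f = (\<lambda>n q. term_act G s f n q + term_act G t f n q)"
| "term_act G (Neg t) f = (\<lambda>n q. - term_act G t f n q)"
| "term_act G (Mult s t) f = term_act G s (term_act G t f)"
| "term_act G (Scale a t) f = (\<lambda>n q. a * term_act G t f n q)"

text \<open>Terms act linearly, which is what \<open>distrib_left\<close> and, through
  \<open>term_act_scale\<close>, \<open>Mult_Scale_right\<close> demand of a representation.\<close>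

lemma term_act_add:
  "term_act G t (\<lambda>n q. f n q + g n q) = (\<lambda>n q. term_act G t f n q + term_act G t g n q)"
proof (induction t arbitrary: f g)
  case (Mult s t)
  then show ?case
    by simp
qed (auto simp: fun_eq_iff algebra_simps)

lemma term_act_scale: "term_act G t (\<lambda>n q. a * f n q) = (\<lambda>n q. a * term_act G t f n q)"
proof (induction t arbitrary: f)
  case (Mult s t)
  then show ?case
    by simp
qed (auto simp: fun_eq_iff algebra_simps)

lemma term_act_edge_ghost:
  assumes "boundary_path G q" "q 0 = Inr f"
  shows "term_act G (Mult (Edge e) (Ghost e)) g n q = (if e = f then g n q else 0)"
proof -
  obtain p where "q = prefix_arc f p" "boundary_path G p" "seq_source G (p 0) = head G f"
    using assms by (cases rule: boundary_path_cases) auto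
  then show ?thesis
    using assms by (auto simp: prefix_arc_tail)
qed

lemma term_act_edge_ghost_sum:
  assumes q: "boundary_path G q" and es: "distinct es"
  shows "term_act G (foldr (\<lambda>e t. Add (Mult (Edge e) (Ghost e)) t) es Zero) g n q =
    (if q 0 \<in> Inr ` set es then g n q else 0)"
  using es
proof (induction es)
  case (Cons e es)
  show ?case
  proof (cases "q 0")
    case (Inl v)
    with Cons show ?thesis
      by auto
  next
    case (Inr f)
    then have "term_act G (Mult (Edge e) (Ghost e)) g n q = (if e = f then g n q else 0)"
      using q by (rule_tac term_act_edge_ghost)
    with Cons Inr show ?thesis
      by (auto simp del: term_act.simps(7))
  qed
qed simp

text \<open>All defining relations hold for the operators, so the action descends to the Leavitt
  path algebra.\<close>

lemma term_act_cong:
  assumes "wf_digraph G" "(s, t) \<in> lpa_cong G"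
  shows "term_act G s = term_act G t"
  using assms(2)
proof (induction rule: lpa_cong.induct)
  case (CK2 v es)
  show ?case
  proof (intro ext)
    fix g n q
    show "term_act G (Vertex v) g n q =
      term_act G (foldr (\<lambda>e t. Add (Mult (Edge e) (Ghost e)) t) es Zero) g n q"
    proof (cases "boundary_path G q")
      case True
      \<comment> \<open>A boundary path with regular source cannot be padding from the start, so it
        begins with one of the edges in \<open>es\<close>.\<close>
      then have "q 0 \<in> Inr ` set es \<longleftrightarrow> seq_source G (q 0) = v"
        using CK2 by (cases rule: boundary_path_cases) (auto simp: out_arcs_def)
      with True CK2 show ?thesis
        by (simp add: term_act_edge_ghost_sum)
    next
      case False
      have "term_act G (foldr (\<lambda>e t. Add (Mult (Edge e) (Ghost e)) t) es Zero) g n q = 0" for es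
        using False by (induction es) auto
      with False show ?thesis
        by simp
    qed
  qed
next
  case (Mult_cong x x' y y')
  then show ?case
    by (intro ext) simp
next
  case (source_Edge e)
  then show ?case
    by (auto simp: fun_eq_iff)
next
  case (Edge_range e)
  show ?case
    by (auto simp: fun_eq_iff elim: boundary_path_cases)
next
  case (CK1_same e)
  have "tail G e = seq_source G (prefix_arc e p 0)" for p
    by simp
  with CK1_same show ?case
    by (auto simp: fun_eq_iff)
qed (auto simp: fun_eq_iff term_act_add term_act_scale algebra_simps)

section \<open>The representation on elements of the algebra\<close>

context lpa
begin

text \<open>The choice of the representing term is immaterial by
  \<open>term_act_cong\<close>.\<close>

definition act :: "('k, 'a, 'b) lpa_term set \<Rightarrow> ('k, 'a, 'b) boundary_fun \<Rightarrow> ('k, 'a, 'b) boundary_fun"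
  where "act x = term_act G (SOME t. t \<in> lpa_terms G \<and> x = lpa_class G t)"

lemma act_class:
  assumes "t \<in> lpa_terms G"
  shows "act (lpa_class G t) = term_act G t"
proof -
  let ?s = "SOME s. s \<in> lpa_terms G \<and> lpa_class G t = lpa_class G s"
  have "?s \<in> lpa_terms G \<and> lpa_class G t = lpa_class G ?s"
    by (rule someI[of _ t]) (use assms in simp)
  then have "(t, ?s) \<in> lpa_cong G"
    using assms lpa_class_eq_iff by blast
  then show ?thesis
    unfolding act_def by (metis term_act_cong wf_digraph_axioms)
qed

lemma act_zero: "act \<zero> f = (\<lambda>n q. 0)"
  by (simp add: class_simps(2) act_class)

lemma act_add: "x \<in> carrier \<Longrightarrow> y \<in> carrier \<Longrightarrow> act (x \<oplus> y) f = (\<lambda>n q. act x f n q + act y f n q)"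
  by (auto simp: class_simps(3) act_class elim!: carrierE)

lemma act_mult: "x \<in> carrier \<Longrightarrow> y \<in> carrier \<Longrightarrow> act (x \<otimes> y) f = act x (act y f)"
  by (auto simp: class_simps(4) act_class elim!: carrierE)

lemma act_scale: "x \<in> carrier \<Longrightarrow> act (a \<odot> x) f = (\<lambda>n q. a * act x f n q)"
  by (auto simp: class_simps(6) act_class elim!: carrierE)

definition delta :: "int \<Rightarrow> (nat \<Rightarrow> 'a + 'b) \<Rightarrow> ('k, 'a, 'b) boundary_fun" where
  "delta n p = (\<lambda>n' p'. if n' = n \<and> p' = p then 1 else 0)"

abbreviation prefix :: "'b list \<Rightarrow> (nat \<Rightarrow> 'a + 'b) \<Rightarrow> nat \<Rightarrow> 'a + 'b" where
  "prefix l p \<equiv> foldr prefix_arc l p"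

lemma prefix_eq_iff: "length l = length m \<Longrightarrow> prefix l p = prefix m p \<longleftrightarrow> l = m"
  by (induction l m rule: list_induct2) auto

lemma boundary_path_prefix:
  "awalk u l w \<Longrightarrow> boundary_path G p \<Longrightarrow> seq_source G (p 0) = w \<Longrightarrow>
     boundary_path G (prefix l p) \<and> seq_source G (prefix l p 0) = u"
  by (induction l arbitrary: u) (auto simp: awalk_simps)

lemma act_vertex_delta:
  "v \<in> verts G \<Longrightarrow> boundary_path G p \<Longrightarrow> seq_source G (p 0) = v \<Longrightarrow>
     act (vertex v) (delta n p) = delta n p"
  by (simp add: act_class) (auto simp: delta_def intro!: ext)

lemma act_edge_delta:
  "e \<in> arcs G \<Longrightarrow> boundary_path G p \<Longrightarrow> seq_source G (p 0) = head G e \<Longrightarrow>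
     act (edge e) (delta n p) = delta (n + 1) (prefix_arc e p)"
  by (simp add: act_class)
    (auto simp: delta_def prefix_arc_tail simp flip: eq_prefix_arc_iff intro!: ext)

lemma act_path_delta:
  assumes "awalk u l w" "boundary_path G p" "seq_source G (p 0) = w"
  shows "act (path u l) (delta n p) = delta (n + int (length l)) (prefix l p)"
  using assms(1)
proof (induction l arbitrary: u)
  case Nil
  then show ?case
    using assms by (auto simp: act_vertex_delta awalk_simps)
next
  case (Cons e l)
  then have "awalk (head G e) l w" "e \<in> arcs G"
    by (auto simp: awalk_simps)
  then show ?case
    using Cons.IH boundary_path_prefix[of "head G e" l w p] assms(2,3)
    by (simp add: act_mult act_edge_delta add_ac)
qed

lemma act_ghost_path:
  assumes "awalk u l w" "boundary_path G p" "seq_source G (p 0) = w"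
  shows "act (ghost_path u l) f n p = f (n + int (length l)) (prefix l p)"
  using assms(1)
proof (induction l arbitrary: u f)
  case Nil
  then show ?case
    using assms by (auto simp: act_class awalk_simps)
next
  case (Cons e l)
  then have "awalk (head G e) l w" "e \<in> arcs G"
    by (auto simp: awalk_simps)
  then show ?case
    using Cons.IH boundary_path_prefix[of "head G e" l w p] assms(2,3)
    by (simp add: act_mult act_class add_ac)
qed

section \<open>Reduction to polynomials in real paths\<close>

text \<open>The bound \<open>n\<close> is the induction measure for removing ghosts;
  \<open>poly 0 w\<close> describes combinations of real paths ending at \<open>w\<close>.\<close>

definition poly :: "nat \<Rightarrow> 'a \<Rightarrow> ('k, 'a, 'b) monomial list \<Rightarrow> bool" where
  "poly n w its \<longleftrightarrow> (\<forall>it \<in> set its. wf_monom w it \<and> length (ghost_part it) \<le> n)"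

lemma poly_closed: "poly n w its \<Longrightarrow> monom ` set its \<subseteq> carrier"
  unfolding poly_def using monom_closed by blast

fun coeff :: "('k, 'a, 'b) monomial \<Rightarrow> 'k" where "coeff (k, u, l, v, m) = k"

fun real_part :: "('k, 'a, 'b) monomial \<Rightarrow> 'b list" where "real_part (k, u, l, v, m) = l"

lemma real_monomE:
  assumes "wf_monom w it" "ghost_part it = []"
  obtains u where "awalk u (real_part it) w" "monom it = coeff it \<odot> path u (real_part it)"
  using assms by (cases it) (auto simp: awalk_Nil_iff path_vertex)

text \<open>The degree \<open>n + int (length l)\<close> singles out the real paths as long as
  \<open>l\<close>, and among paths of one length \<open>prefix\<close> is injective. So only the
  coefficients of \<open>l\<close> itself are counted.\<close>

lemma act_real_poly:
  assumes "poly 0 w its" "boundary_path G p" "seq_source G (p 0) = w"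
  shows "act (lsum (map monom its)) (delta n p) (n + int (length l)) (prefix l p) =
    sum_list (map coeff (filter (\<lambda>it. real_part it = l) its))"
  using assms(1)
proof (induction its)
  case (Cons it its)
  then have it: "wf_monom w it" "ghost_part it = []" and its: "poly 0 w its"
    by (auto simp: poly_def)
  then obtain u where u: "awalk u (real_part it) w" "monom it = coeff it \<odot> path u (real_part it)"
    using real_monomE by blast
  have "act (monom it) (delta n p) (n + int (length l)) (prefix l p) =
      (if real_part it = l then coeff it else 0)"
    using u assms(2,3) prefix_eq_iff[of l "real_part it" p]
    by (simp add: act_scale act_path_delta) (auto simp: delta_def)
  moreover have "lsum (map monom its) \<in> carrier"
    using poly_closed[OF its] by (intro lsum_closed) simp
  ultimately show ?case
    using Cons.IH[OF its] monom_closed[OF it(1)] by (simp add: act_add)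
qed (simp add: act_zero)

text \<open>Group the monomials by their real path. A group with nonzero sum is a scalar multiple of
  a single path, so its total coefficient is nonzero, and the representation shows this coefficient
  on every boundary path from \<open>w\<close>.\<close>

lemma real_poly_nonzero:
  assumes its: "poly 0 w its" and nz: "lsum (map monom its) \<noteq> \<zero>"
  obtains u l where "awalk u l w"
    "\<And>n p. boundary_path G p \<Longrightarrow> seq_source G (p 0) = w \<Longrightarrow>
      act (lsum (map monom its)) (delta n p) (n + int (length l)) (prefix l p) \<noteq> 0"
proof -
  obtain l where l: "lsum (map monom (filter (\<lambda>it. real_part it = l) its)) \<noteq> \<zero>"
    using nz lsum_fibres_zero[of monom its real_part] poly_closed[OF its] by blast
  let ?its = "filter (\<lambda>it. real_part it = l) its"
  \<comment> \<open>The source is determined by \<open>l\<close> and \<open>w\<close>, so all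
    monomials of the group involve the same path.\<close>
  define u where "u = (if l = [] then w else tail G (hd l))"
  have mon: "awalk u l w \<and> monom it = coeff it \<odot> path u l" if it: "it \<in> set ?its" for it
  proof -
    have "wf_monom w it" "ghost_part it = []" "real_part it = l"
      using it its by (auto simp: poly_def)
    then obtain u' where "awalk u' l w" "monom it = coeff it \<odot> path u' l"
      using real_monomE by metis
    moreover from this have "u' = u"
      by (cases l) (auto simp: u_def awalk_simps)
    ultimately show ?thesis
      by simp
  qed
  have "?its \<noteq> []"
    using l by auto
  then obtain it where "it \<in> set ?its"
    using hd_in_set by blast
  then have u: "awalk u l w"
    using mon by blast
  have "map monom ?its = map (\<lambda>it. coeff it \<odot> path u l) ?its"
    using mon by (intro map_cong) auto
  then have "lsum (map monom ?its) = sum_list (map coeff ?its) \<odot> path u l"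
    using lsum_scale_const[OF path_closed[OF u], of coeff ?its] by (simp only:)
  then have "sum_list (map coeff ?its) \<noteq> 0"
    using l u by (auto simp: path_closed)
  with that[OF u] show thesis
    by (simp add: act_real_poly[OF its])
qed

section \<open>Right multiplication by an edge\<close>

fun monom_edge :: "'b \<Rightarrow> ('k, 'a, 'b) monomial \<Rightarrow> ('k, 'a, 'b) monomial list" where
  "monom_edge e (k, u, l, v, []) = [(k, u, l @ [e], head G e, [])]"
| "monom_edge e (k, u, l, v, f # m) = (if f = e then [(k, u, l, head G e, m)] else [])"

text \<open>The first edge of the ghost path is its rightmost factor, so it meets \<open>e\<close>
  and CK1 applies. A product that vanishes is recorded as the empty list.\<close>

lemma monom_mult_edge:
  assumes "e \<in> arcs G" "wf_monom (tail G e) it"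
  shows "monom it \<otimes> edge e = lsum (map monom (monom_edge e it))"
proof (cases "(e, it)" rule: monom_edge.cases)
  case (1 e' k u l v)
  with assms have l: "awalk u l (tail G e)"
    by (auto simp: awalk_Nil_iff)
  then have "path u (l @ [e]) = path u l \<otimes> edge e"
    using assms(1) path_append[of u l "tail G e" "[e]"] by (simp add: awalk_simps relations)
  with 1 l assms show ?thesis
    by (simp add: mult_scale_left mult_assoc relations)
next
  case (2 e' k u l v f m)
  with assms obtain w where w: "awalk u l w" "f \<in> arcs G" "awalk (head G f) m w"
    by (auto simp: awalk_Cons_iff)
  then have "ghost_path (head G f) m \<otimes> ghost f \<otimes> edge e =
      (if f = e then ghost_path (head G f) m else \<zero>)"
    using assms(1) by (auto simp: mult_assoc relations ghost_path_vertex)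
  with 2 w assms(1) show ?thesis
    by (auto simp: mult_scale_left mult_assoc)
qed

text \<open>Truncated subtraction covers both cases: a nonempty ghost path loses an edge, an empty
  one stays empty.\<close>

lemma monom_edge_wf:
  assumes "e \<in> arcs G" "wf_monom (tail G e) it" "it' \<in> set (monom_edge e it)"
  shows "wf_monom (head G e) it'" "length (ghost_part it') \<le> length (ghost_part it) - 1"
  using assms by (cases "(e, it)" rule: monom_edge.cases; force simp: awalk_simps split: if_splits)+

lemma poly_mult_edge:
  assumes its: "poly n (tail G e) its" and e: "e \<in> arcs G"
  obtains jts where "poly (n - 1) (head G e) jts"
    "lsum (map monom its) \<otimes> edge e = lsum (map monom jts)"
proof
  let ?jts = "concat (map (monom_edge e) its)"
  show jts: "poly (n - 1) (head G e) ?jts"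
    unfolding poly_def
  proof
    fix jt
    assume "jt \<in> set ?jts"
    then obtain it where it: "it \<in> set its" "jt \<in> set (monom_edge e it)"
      by auto
    then have "wf_monom (tail G e) it" "length (ghost_part it) \<le> n"
      using its by (simp_all add: poly_def)
    with monom_edge_wf[OF e this(1) it(2)]
    show "wf_monom (head G e) jt \<and> length (ghost_part jt) \<le> n - 1"
      by simp
  qed
  have "lsum (map monom its) \<otimes> edge e = lsum (map (\<lambda>it. monom it \<otimes> edge e) its)"
    using poly_closed[OF its] e by (intro lsum_mult_right) auto
  also have "\<dots> = lsum (map (\<lambda>it. lsum (map monom (monom_edge e it))) its)"
  proof -
    have "map (\<lambda>it. monom it \<otimes> edge e) its = map (\<lambda>it. lsum (map monom (monom_edge e it))) its"
      using its unfolding poly_def by (intro map_cong) (blast intro: monom_mult_edge[OF e])+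
    then show ?thesis
      by (simp only:)
  qed
  also have "\<dots> = lsum (map monom ?jts)"
    using poly_closed[OF jts] by (simp add: lsum_concat comp_def)
  finally show "lsum (map monom its) \<otimes> edge e = lsum (map monom ?jts)" .
qed

lemma poly_vertex:
  assumes "poly n v its" "v \<in> verts G"
  shows "lsum (map monom its) \<otimes> vertex v = lsum (map monom its)"
proof -
  have "map (\<lambda>it. monom it \<otimes> vertex v) its = map monom its"
    using assms unfolding poly_def by (intro map_cong) (blast intro: monom_vertex)+
  with lsum_mult_right[of "vertex v" monom its] show ?thesis
    using poly_closed[OF assms(1)] assms(2) by (simp only: generators_closed)
qed

section \<open>Removing ghost edges\<close>

abbreviation edge_idem :: "'b list \<Rightarrow> ('k, 'a, 'b) lpa_term set" where
  "edge_idem es \<equiv> lsum (map (\<lambda>e. edge e \<otimes> ghost e) es)"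

lemma edge_idem_closed [simp]: "set es \<subseteq> arcs G \<Longrightarrow> edge_idem es \<in> carrier"
  by (rule lsum_closed) (auto dest: subsetD)

lemma mult_edge_idem_zero:
  assumes "x \<in> carrier" "set es \<subseteq> arcs G" "\<And>e. e \<in> set es \<Longrightarrow> x \<otimes> edge e = \<zero>"
  shows "x \<otimes> edge_idem es = \<zero>"
proof -
  have "x \<otimes> (edge e \<otimes> ghost e) = \<zero>" if "e \<in> set es" for e
  proof -
    have "e \<in> arcs G"
      using that assms(2) by auto
    then show ?thesis
      using assms(1) assms(3)[OF that] by (simp flip: mult_assoc)
  qed
  then show ?thesis
    using assms(1,2) by (subst lsum_mult_left) (auto intro!: lsum_zero)
qed

lemma ghost_edge_idem:
  "distinct es \<Longrightarrow> set es \<subseteq> arcs G \<Longrightarrow> f \<in> arcs G \<Longrightarrow>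
     ghost f \<otimes> edge_idem es = (if f \<in> set es then ghost f else \<zero>)"
proof (induction es)
  case (Cons e es)
  have "ghost f \<otimes> (edge e \<otimes> ghost e) = (if f = e then ghost f else \<zero>)"
    using Cons.prems mult_assoc[of "ghost f" "edge e" "ghost e"] by (auto simp: relations)
  then show ?case
    using Cons by (auto simp: distrib_left)
qed simp

text \<open>Suppose all \<open>x e\<close> vanish. At a regular vertex, CK2 writes \<open>x\<close>
  as a sum of \<open>x e\<close> times ghosts, which is zero. At an infinite emitter, an edge that
  starts none of the ghost paths kills the ghost terms, so the real terms sum to zero; the rest is
  fixed by the finite idempotent of the initial ghost edges, which \<open>x\<close>
  annihilates.\<close>

lemma exists_nonzero_edge:
  assumes its: "poly n v its" and nz: "lsum (map monom its) \<noteq> \<zero>" and ghosts: "\<not> poly 0 v its"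
  obtains e where "e \<in> arcs G" "tail G e = v" "lsum (map monom its) \<otimes> edge e \<noteq> \<zero>"
proof (rule ccontr)
  define x where "x = lsum (map monom its)"
  assume "\<not> thesis"
  with that have zero: "x \<otimes> edge e = \<zero>" if "e \<in> out_arcs G v" for e
    using \<open>e \<in> out_arcs G v\<close> by (auto simp: x_def out_arcs_def)
  have [simp]: "x \<in> carrier"
    using poly_closed[OF its] by (auto simp: x_def)
  let ?C = "filter (\<lambda>it. ghost_part it \<noteq> []) its"
  have C: "v \<in> verts G \<and> (\<exists>k u l f m w. it = (k, u, l, v, f # m) \<and> f \<in> out_arcs G v \<and>
      awalk u l w \<and> awalk (head G f) m w)" if "it \<in> set ?C" for it
  proof -
    have "wf_monom v it" "ghost_part it \<noteq> []"
      using that its by (auto simp: poly_def)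
    then show ?thesis
      by (cases it; cases "ghost_part it") (auto simp: awalk_Cons_iff out_arcs_def)
  qed
  \<comment> \<open>A monomial with a ghost edge shows that \<open>v\<close> is not a sink.\<close>
  obtain it where "it \<in> set its" "\<not> (wf_monom v it \<and> length (ghost_part it) \<le> 0)"
    using ghosts unfolding poly_def by blast
  then have "it \<in> set ?C"
    using its by (auto simp: poly_def)
  then have v: "v \<in> verts G" and out: "out_arcs G v \<noteq> {}"
    using C by blast+
  show False
  proof (cases "regular_vertex G v")
    case True
    then obtain es where es: "set es = out_arcs G v" "vertex v = edge_idem es"
      by (rule vertex_regular)
    then have "x \<otimes> vertex v = \<zero>"
      using mult_edge_idem_zero[of x es] zero by (auto simp: out_arcs_def)
    then show False
      using nz poly_vertex[OF its v] by (simp add: x_def)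
  next
    case False
    let ?A = "filter (\<lambda>it. ghost_part it = []) its"
    let ?F = "(\<lambda>it. hd (ghost_part it)) ` set ?C"
    have A: "poly 0 v ?A" and polyC: "poly n v ?C"
      using its by (auto simp: poly_def)
    have closed: "lsum (map monom ?A) \<in> carrier" "lsum (map monom ?C) \<in> carrier"
      using poly_closed[OF A] poly_closed[OF polyC] by auto
    have x: "x = lsum (map monom ?A) \<oplus> lsum (map monom ?C)"
      unfolding x_def by (rule lsum_partition) (rule poly_closed[OF its])
    have "infinite (out_arcs G v)"
      using False v out by (simp add: regular_vertex_def)
    then have "\<not> out_arcs G v \<subseteq> ?F"
      using finite_subset by blast
    then obtain e where e: "e \<in> arcs G" "tail G e = v" "e \<notin> ?F"
      by (auto simp: out_arcs_def)
    have "monom it \<otimes> edge e = \<zero>" if it: "it \<in> set ?C" for it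
    proof -
      have "monom it \<otimes> edge e = lsum (map monom (monom_edge e it))"
        using it its e by (intro monom_mult_edge) (auto simp: poly_def)
      moreover obtain k u l f m where f: "it = (k, u, l, v, f # m)"
        using C[OF it] by blast
      moreover have "f \<in> ?F"
        using it f by (intro image_eqI[of _ _ it]) simp_all
      then have "monom_edge e it = []"
        using e(3) f by auto
      ultimately show ?thesis
        by simp
    qed
    then have "lsum (map monom ?C) \<otimes> edge e = \<zero>"
      using poly_closed[OF polyC] e by (subst lsum_mult_right) (auto intro!: lsum_zero)
    then have Ae: "lsum (map monom ?A) \<otimes> edge e = \<zero>"
      using zero[of e] e closed by (simp add: x distrib_right out_arcs_def)
    have "lsum (map monom ?A) = \<zero>"
    proof (rule ccontr)
      assume "lsum (map monom ?A) \<noteq> \<zero>"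
      then obtain u l where l: "\<And>n p. boundary_path G p \<Longrightarrow> seq_source G (p 0) = v \<Longrightarrow>
          act (lsum (map monom ?A)) (delta n p) (n + int (length l)) (prefix l p) \<noteq> 0"
        using real_poly_nonzero[OF A] by metis
      \<comment> \<open>Testing \<open>A e\<close> on \<open>p\<close> amounts to testing
        \<open>A\<close> on \<open>e p\<close>, a boundary path from \<open>v\<close>, where a
        nonzero real polynomial is detected.\<close>
      obtain p where p: "boundary_path G p" "seq_source G (p 0) = head G e"
        using e boundary_path_exists[of "head G e"] by auto
      have "act (lsum (map monom ?A) \<otimes> edge e) (delta 0 p) =
          act (lsum (map monom ?A)) (delta 1 (prefix_arc e p))"
        using p e closed by (simp add: act_mult act_edge_delta)
      then have "act (lsum (map monom ?A) \<otimes> edge e) (delta 0 p) (1 + int (length l))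
          (prefix l (prefix_arc e p)) \<noteq> 0"
        using l[of "prefix_arc e p" 1] p e by simp
      then show False
        by (simp add: Ae act_zero)
    qed
    with x closed have xC: "x = lsum (map monom ?C)"
      by simp
    obtain es where es: "set es = ?F" "distinct es"
      using finite_distinct_list[of ?F] by auto
    have F: "?F \<subseteq> out_arcs G v"
      using C by fastforce
    then have arcs: "set es \<subseteq> arcs G"
      using es by (auto simp: out_arcs_def)
    have "monom it \<otimes> edge_idem es = monom it" if it: "it \<in> set ?C" for it
    proof -
      obtain k u l f m w where *: "it = (k, u, l, v, f # m)" "f \<in> out_arcs G v"
        "awalk u l w" "awalk (head G f) m w"
        using C[OF it] by blast
      have "f \<in> ?F"
        using it *(1) by (intro image_eqI[of _ _ it]) simp_all
      then have "f \<in> set es"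
        by (simp only: es(1))
      then show ?thesis
        using * arcs es(2) ghost_edge_idem[of es f]
        by (simp add: mult_scale_left mult_assoc out_arcs_def)
    qed
    then have "map (\<lambda>it. monom it \<otimes> edge_idem es) ?C = map monom ?C"
      by (rule map_cong[OF HOL.refl])
    then have "x \<otimes> edge_idem es = x"
      unfolding xC
      using lsum_mult_right[OF edge_idem_closed[OF arcs] poly_closed[OF polyC]] by (simp only:)
    moreover have "x \<otimes> edge_idem es = \<zero>"
      using F es zero arcs by (intro mult_edge_idem_zero) auto
    ultimately show False
      using nz by (simp add: x_def)
  qed
qed

text \<open>Each edge supplied by \<open>exists_nonzero_edge\<close> lowers the ghost bound by one
  and keeps the product nonzero.\<close>

lemma reduce_to_real_poly:
  assumes "poly n v its" "lsum (map monom its) \<noteq> \<zero>"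
  shows "\<exists>q w jts. awalk v q w \<and> poly 0 w jts \<and> lsum (map monom jts) \<noteq> \<zero> \<and>
    lsum (map monom its) \<otimes> path v q = lsum (map monom jts)"
  using assms
proof (induction n arbitrary: v its)
  case 0
  then have "its \<noteq> []"
    by auto
  then obtain it where "it \<in> set its"
    using hd_in_set by blast
  then have "wf_monom v it"
    using 0 by (simp add: poly_def)
  then have "v \<in> verts G"
    by (cases it) auto
  then show ?case
    using 0 poly_vertex[OF 0(1)]
    by (intro exI[of _ "[]"] exI[of _ v] exI[of _ its]) (simp add: awalk_Nil_iff)
next
  case (Suc n)
  show ?case
  proof (cases "poly 0 v its")
    case True
    then show ?thesis
      using Suc.IH[of v its] Suc.prems by (auto simp: poly_def)
  next
    case False
    with Suc.prems obtain e where e: "e \<in> arcs G" "tail G e = v"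
      "lsum (map monom its) \<otimes> edge e \<noteq> \<zero>"
      by (rule exists_nonzero_edge)
    then obtain jts where jts: "poly n (head G e) jts"
      "lsum (map monom its) \<otimes> edge e = lsum (map monom jts)"
      using poly_mult_edge[of "Suc n" e its] Suc.prems by auto
    then obtain q w kts where q: "awalk (head G e) q w" "poly 0 w kts" "lsum (map monom kts) \<noteq> \<zero>"
      "lsum (map monom jts) \<otimes> path (head G e) q = lsum (map monom kts)"
      using Suc.IH[of "head G e" jts] e by auto
    have "lsum (map monom its) \<in> carrier"
      using poly_closed[OF Suc.prems(1)] by auto
    then have "lsum (map monom its) \<otimes> path v (e # q) = lsum (map monom kts)"
      using q(1,4) e jts(2) by (simp flip: mult_assoc)
    moreover have "awalk v (e # q) w"
      using q(1) e by (simp add: awalk_Cons_iff)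
    ultimately show ?thesis
      using q(2,3) by blast
  qed
qed

text \<open>With no unit at hand, group the monomials of \<open>x\<close> by their right vertex;
  multiplying by a vertex selects its group, and some group has nonzero sum.\<close>

lemma exists_nonzero_vertex:
  assumes x: "x \<in> carrier" "x \<noteq> \<zero>"
  obtains n v its where "v \<in> verts G" "poly n v its" "x \<otimes> vertex v = lsum (map monom its)"
    "lsum (map monom its) \<noteq> \<zero>"
proof -
  obtain its where its: "\<forall>it \<in> set its. \<exists>v. wf_monom v it" "x = lsum (map monom its)"
    using spanned[OF x(1)] unfolding spanned_def by blast
  define source :: "('k, 'a, 'b) monomial \<Rightarrow> 'a" where "source = (\<lambda>(k, u, l, v, m). v)"
  have wf: "wf_monom (source it) it" if "it \<in> set its" for it
    using bspec[OF its(1) that] by (cases it) (auto simp: source_def)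
  have closed: "monom ` set its \<subseteq> carrier"
    by (rule monoms_closed[OF its(1)])
  then obtain v where v: "lsum (map monom (filter (\<lambda>it. source it = v) its)) \<noteq> \<zero>"
    using x(2) its(2) lsum_fibres_zero[of monom its source] by blast
  let ?jts = "filter (\<lambda>it. source it = v) its"
  have "?jts \<noteq> []"
    using v by auto
  then obtain it where "it \<in> set ?jts"
    using hd_in_set by blast
  then have "wf_monom v it"
    using wf[of it] by auto
  then have vert: "v \<in> verts G"
    by (cases it) auto
  have "monom it \<otimes> vertex v = \<zero>" if it: "it \<in> set its" "source it \<noteq> v" for it
  proof -
    have [simp]: "monom it \<in> carrier"
      using it closed by auto
    have s: "source it \<in> verts G"
      using wf[OF it(1)] by (cases it) auto
    have "monom it \<otimes> vertex v = monom it \<otimes> vertex (source it) \<otimes> vertex v"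
      using monom_vertex[OF wf[OF it(1)]] by simp
    also have "\<dots> = monom it \<otimes> (vertex (source it) \<otimes> vertex v)"
      using s vert by (intro mult_assoc) auto
    also have "\<dots> = \<zero>"
      using s vert it by (simp add: relations)
    finally show ?thesis .
  qed
  then have "lsum (map monom (filter (\<lambda>it. source it \<noteq> v) its)) \<otimes> vertex v = \<zero>"
    using closed vert by (subst lsum_mult_right) (auto intro!: lsum_zero)
  moreover have jts: "poly (\<Sum>it \<leftarrow> its. length (ghost_part it)) v ?jts"
    unfolding poly_def
  proof
    fix it
    assume "it \<in> set ?jts"
    then have it: "it \<in> set its" "source it = v"
      by simp_all
    have "length (ghost_part it) \<in> set (map (\<lambda>it. length (ghost_part it)) its)"
      unfolding set_map using it(1) by (rule imageI)
    then have "length (ghost_part it) \<le> (\<Sum>it \<leftarrow> its. length (ghost_part it))"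
      by (rule member_le_sum_list) simp
    with wf[OF it(1)] it(2)
    show "wf_monom v it \<and> length (ghost_part it) \<le> (\<Sum>it \<leftarrow> its. length (ghost_part it))"
      by blast
  qed
  moreover have "x = lsum (map monom ?jts) \<oplus> lsum (map monom (filter (\<lambda>it. source it \<noteq> v) its))"
    unfolding its(2) by (rule lsum_partition[OF closed])
  moreover have "lsum (map monom (filter P its)) \<in> carrier" for P
    by (rule lsum_closed, unfold set_map)
      (rule order_trans[OF image_mono[OF filter_is_subset] closed])
  ultimately have "x \<otimes> vertex v = lsum (map monom ?jts)"
    using vert poly_vertex[OF jts vert] by (simp add: distrib_right)
  then show thesis
    using that vert jts v by blast
qed

text \<open>If \<open>ghost_path u (l @ t)\<close> annihilated \<open>x\<close>, it would annihilate
  the real polynomial obtained from \<open>x\<close>. Following \<open>l\<close> by a path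
  \<open>t\<close> into \<open>X\<close> does not hide the coefficient of \<open>l\<close>, since
  the test path may be chosen to begin with \<open>t\<close>.\<close>

lemma nonzero_ghost_mult:
  assumes x: "x \<in> carrier" "x \<noteq> \<zero>" and X: "\<And>v. v \<in> verts G \<Longrightarrow> \<exists>p. \<exists>z \<in> X. awalk v p z"
  shows "\<exists>u p z. z \<in> X \<and> awalk u p z \<and> ghost_path u p \<otimes> x \<noteq> \<zero>"
proof -
  obtain n v its where its: "v \<in> verts G" "poly n v its" "x \<otimes> vertex v = lsum (map monom its)"
    "lsum (map monom its) \<noteq> \<zero>"
    using x by (rule exists_nonzero_vertex)
  obtain q w jts where q: "awalk v q w" "poly 0 w jts" "lsum (map monom jts) \<noteq> \<zero>"
    "lsum (map monom its) \<otimes> path v q = lsum (map monom jts)"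
    using reduce_to_real_poly[OF its(2,4)] by blast
  then have xq: "x \<otimes> path v q = lsum (map monom jts)"
    using mult_assoc[of x "vertex v" "path v q"] its(1,3) x(1) vertex_path[OF q(1)] path_closed[OF q(1)]
    by simp
  obtain u l where l: "awalk u l w"
    "\<And>n p. boundary_path G p \<Longrightarrow> seq_source G (p 0) = w \<Longrightarrow>
      act (lsum (map monom jts)) (delta n p) (n + int (length l)) (prefix l p) \<noteq> 0"
    using real_poly_nonzero[OF q(2,3)] by metis
  obtain t z where t: "z \<in> X" "awalk w t z"
    using X[of w] q(1) by auto
  obtain p where p: "boundary_path G p" "seq_source G (p 0) = z"
    using boundary_path_exists[of z] t(2) by auto
  have lt: "awalk u (l @ t) z"
    using l(1) t(2) by (rule awalk_appendI)
  have "ghost_path u (l @ t) \<otimes> x \<noteq> \<zero>"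
  proof
    assume "ghost_path u (l @ t) \<otimes> x = \<zero>"
    then have "ghost_path u (l @ t) \<otimes> (x \<otimes> path v q) = \<zero>"
      using mult_assoc[of "ghost_path u (l @ t)" x "path v q"] x(1) path_closed[OF q(1)]
        ghost_path_closed[OF lt] by simp
    \<comment> \<open>The degrees balance: \<open>t\<close> raises 0 to its length, the coefficient
      of \<open>l\<close> sits \<open>length l\<close> higher, and the ghost path reads it off at
      degree 0.\<close>
    then have "act (ghost_path u (l @ t)) (act (lsum (map monom jts)) (act (path w t) (delta 0 p))) 0 p = 0"
      using ghost_path_closed[OF lt] poly_closed[OF q(2)]
      by (simp add: xq act_zero flip: act_mult)
    then have "act (lsum (map monom jts)) (delta (int (length t)) (prefix t p))
        (int (length t) + int (length l)) (prefix l (prefix t p)) = 0"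
      using act_ghost_path[OF lt p] act_path_delta[OF t(2) p] by (simp add: add.commute)
    then show False
      using l(2)[of "prefix t p" "int (length t)"] boundary_path_prefix[OF t(2) p] by simp
  qed
  with t(1) lt show ?thesis
    by blast
qed

end

theorem proposition2p4:
  fixes E :: "('a, 'b) pre_digraph"
  assumes "wf_digraph E"
  shows "dense_ideal (leavitt_path_algebra E :: ('k::field, ('k, 'a, 'b) lpa_term set) rng_algebra)
    (rng_ideal_generated (leavitt_path_algebra E)
      ((\<lambda>v. lpa_class E (Vertex v)) ` (P_l E \<union> P_c E \<union> P_ec E \<union> P_binf E)))"
proof -
  let ?L = "leavitt_path_algebra E :: ('k, ('k, 'a, 'b) lpa_term set) rng_algebra"
  let ?X = "P_l E \<union> P_c E \<union> P_ec E \<union> P_binf E"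
  let ?I = "rng_ideal_generated ?L ((\<lambda>v. lpa_class E (Vertex v)) ` ?X)"
  interpret lpa E ?L
    using assms nonunital_algebra_leavitt_path_algebra by (simp add: lpa_def lpa_axioms_def)
  have "vertex ` ?X \<subseteq> rng_carrier ?L"
    using distinguished_verts by auto
  then have I: "rng_ideal ?L ?I"
    by (rule rng_ideal_generated_ideal[OF nonunital_ring_axioms])
  then show ?thesis
  proof (rule dense_ideal_if_no_annihilator)
    fix x
    assume "x \<in> rng_carrier ?L" "x \<noteq> rng_zero ?L"
    moreover have "\<exists>p. \<exists>z \<in> ?X. awalk v p z" if "v \<in> verts E" for v
      using reaches_distinguished[OF that] by metis
    ultimately obtain u p z where p: "z \<in> ?X" "awalk u p z" "rng_mult ?L (ghost_path u p) x \<noteq> rng_zero ?L"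
      using nonzero_ghost_mult[of x ?X] by blast
    have "vertex z \<in> vertex ` ?X"
      using p(1) by (rule imageI)
    then have "vertex z \<in> ?I"
      by (rule subsetD[OF rng_ideal_generated_superset])
    \<comment> \<open>The ghost path has the vertex \<open>z\<close> as a left identity, so it
      inherits membership in the ideal from \<open>vertex z\<close>.\<close>
    then have "rng_mult ?L (vertex z) (ghost_path u p) \<in> ?I"
      using I ghost_path_closed[OF p(2)] unfolding rng_ideal_def by blast
    then have "ghost_path u p \<in> ?I"
      unfolding vertex_ghost_path[OF p(2)] .
    with p(3) show "\<exists>a \<in> ?I. rng_mult ?L a x \<noteq> rng_zero ?L" ..
  qed
qed

end
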